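(* Assume the Continuum Hypothesis. (1) If $\mathcal{I}$ is an ideal (on a countably infinite set) such that $\mathcal{I}\not\leq_K\mathcal{H}$ (respectively $\mathcal{I}\not\leq_K\mathcal{R}$, respectively $\mathcal{I}\not\leq_K\mathcal{D}$), then there exists an almost disjoint family $\mathcal{A}$ such that the Hausdorff compact and separable space $\Phi(\mathcal{A})$ of cardinality $\mathfrak{c}$ is a Hindman (respectively Ramsey, respectively differentially compact) space that is not in $\mathrm{FinBW}(\mathcal{I})$. (2) There exists an almost disjoint family $\mathcal{A}$ such that the Hausdorff compact and separable space $\Phi(\mathcal{A})$ of cardinality $\mathfrak{c}$ is a Hindman (respectively Ramsey, respectively differentially compact) space that is not an $\mathcal{I}_{1/n}$-space.
   Context: $\omega=\{0,1,2,\dots\}$. An ideal on a countably infinite set $\Lambda$ is a nonempty family $\mathcal{I}\subseteq\mathcal{P}(\Lambda)$ closed under subsets and finite unions, containing all finite subsets of $\Lambda$, with $\Lambda\notin\mathcal{I}$; $\mathcal{I}^+=\mathcal{P}(\Lambda)\setminus\mathcal{I}$. For ideals $\mathcal{I}_i$ on $\Lambda_i$, $\mathcal{I}_2\leq_K\mathcal{I}_1$ (Katětov order) if there is $\phi:\Lambda_1\to\Lambda_2$ with $\phi[A]\notin\mathcal{I}_2$ for each $A\notin\mathcal{I}_1$. For infinite $D\subseteq\omega$: $\mathrm{FS}(D)$ is the set of all sums of nonempty finite sets of distinct elements of $D$; $[D]^2$ is the set of unordered pairs of distinct elements of $D$; $\Delta(D)=\{a-b:a,b\in D,\ a>b\}$.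 The ideals: $\mathcal{H}=\{A\subseteq\omega:\mathrm{FS}(D)\not\subseteq A\text{ for all infinite }D\subseteq\omega\}$ on $\omega$; $\mathcal{R}=\{A\subseteq[\omega]^2:[D]^2\not\subseteq A\text{ for all infinite }D\subseteq\omega\}$ on $[\omega]^2$; $\mathcal{D}=\{A\subseteq\omega:\Delta(D)\not\subseteq A\text{ for all infinite }D\subseteq\omega\}$ on $\omega$; $\mathcal{I}_{1/n}=\{A\subseteq\omega:\sum_{n\in A}\frac1{n+1}<\infty\}$ on $\omega$. A topological space $X$ is a Hindman space if for every $f:\omega\to X$ there are an infinite $D\subseteq\omega$ and $x\in X$ such that for every neighbourhood $U$ of $x$ there is a finite $K\subseteq\omega$ with $f[\mathrm{FS}(D\setminus K)]\subseteq U$. $X$ is a Ramsey space if for every $f:[\omega]^2\to X$ there are an infinite $D\subseteq\omega$ and $x\in X$ such that for every neighbourhood $U$ of $x$ there is a finite $K\subseteq\omega$ with $f[[D\setminus K]^2]\subseteq U$. $X$ is differentially compact if for every $f:\omega\to X$ there are an infinite $D\subseteq\omega$ and $x\in X$ such that for every neighbourhood $U$ of $x$ there is a finite $K\subseteq\omega$ with $f[\Delta(D\setminus K)]\subseteq U$. For an ideal $\mathcal{I}$ on $\Lambda$, $\mathrm{FinBW}(\mathcal{I})$ is the class of all topological spaces $X$ such that for every $f:\Lambda\to X$ there is $A\in\mathcal{I}^+$ such that $f\restriction A$ converges (to some $x\in X$: every neighbourhood of $x$ contains $f(a)$ for all but finitely many $a\in A$). An $\mathcal{I}_{1/n}$-space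 is a member of $\mathrm{FinBW}(\mathcal{I}_{1/n})$. An almost disjoint family on a countably infinite set $\Lambda$ is a family $\mathcal{A}$ of infinite subsets of $\Lambda$ with $A\cap B$ finite for distinct $A,B\in\mathcal{A}$. For infinite such $\mathcal{A}$, $\Psi(\mathcal{A})=\Lambda\cup\mathcal{A}$ is the space in which points of $\Lambda$ are isolated and basic neighbourhoods of $A\in\mathcal{A}$ are $\{A\}\cup(A\setminus F)$ with $F$ finite; $\Phi(\mathcal{A})=\Psi(\mathcal{A})\cup\{\infty\}$ is its Alexandroff one-point compactification. *)

theory Defs
  imports "HOL-Analysis.Analysis" "HOL-Library.Ramsey" "HOL-Library.Equipollence"
begin

definition continuum_hypothesis :: bool where
  "continuum_hypothesis \<longleftrightarrow>
     (\<forall>S :: real set. infinite S \<longrightarrow> countable S \<or> S \<approx> (UNIV :: real set))"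

definition ideal_on :: "'a set \<Rightarrow> 'a set set \<Rightarrow> bool" where
  "ideal_on \<Lambda> \<I> \<longleftrightarrow>
     \<I> \<noteq> {} \<and> \<I> \<subseteq> Pow \<Lambda> \<and>
     (\<forall>A\<in>\<I>. \<forall>B. B \<subseteq> A \<longrightarrow> B \<in> \<I>) \<and>
     (\<forall>A\<in>\<I>. \<forall>B\<in>\<I>. A \<union> B \<in> \<I>) \<and>
     (\<forall>F. finite F \<and> F \<subseteq> \<Lambda> \<longrightarrow> F \<in> \<I>) \<and>
     \<Lambda> \<notin> \<I>"

definition positive_sets :: "'a set \<Rightarrow> 'a set set \<Rightarrow> 'a set set" where
  "positive_sets \<Lambda> \<I> = Pow \<Lambda> - \<I>"

text \<open>\<open>katetov_le \<Lambda>2 \<I>2 \<Lambda>1 \<I>1\<close> says that \<open>\<I>2\<close> (on \<open>\<Lambda>2\<close>) is Katetov below \<open>\<I>1\<close> (on \<open>\<Lambda>1\<close>).\<close>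

definition katetov_le :: "'b set \<Rightarrow> 'b set set \<Rightarrow> 'a set \<Rightarrow> 'a set set \<Rightarrow> bool" where
  "katetov_le \<Lambda>2 \<I>2 \<Lambda>1 \<I>1 \<longleftrightarrow>
     (\<exists>\<phi>. \<phi> \<in> \<Lambda>1 \<rightarrow> \<Lambda>2 \<and> (\<forall>A. A \<subseteq> \<Lambda>1 \<and> A \<notin> \<I>1 \<longrightarrow> \<phi> ` A \<notin> \<I>2))"

definition FS :: "nat set \<Rightarrow> nat set" where
  "FS D = {\<Sum>F | F. finite F \<and> F \<noteq> {} \<and> F \<subseteq> D}"

definition Delta :: "nat set \<Rightarrow> nat set" where
  "Delta D = {a - b | a b. a \<in> D \<and> b \<in> D \<and> a > b}"

definition Hindman_ideal :: "nat set set" where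
  "Hindman_ideal = {A. \<forall>D. infinite D \<longrightarrow> \<not> FS D \<subseteq> A}"

definition Ramsey_ideal :: "nat set set set" where
  "Ramsey_ideal = {A. A \<subseteq> [UNIV]\<^bsup>2\<^esup> \<and> (\<forall>D. infinite D \<longrightarrow> \<not> [D]\<^bsup>2\<^esup> \<subseteq> A)}"

definition Delta_ideal :: "nat set set" where
  "Delta_ideal = {A. \<forall>D. infinite D \<longrightarrow> \<not> Delta D \<subseteq> A}"

definition summable_ideal :: "nat set set" where
  "summable_ideal = {A. (\<lambda>n. 1 / (real n + 1)) summable_on A}"

definition Hindman_space :: "'x topology \<Rightarrow> bool" where
  "Hindman_space X \<longleftrightarrow>
     (\<forall>f. f \<in> UNIV \<rightarrow> topspace X \<longrightarrow>
       (\<exists>D x. infinite D \<and> x \<in> topspace X \<and>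
         (\<forall>U. openin X U \<and> x \<in> U \<longrightarrow> (\<exists>K. finite K \<and> f ` FS (D - K) \<subseteq> U))))"

definition Ramsey_space :: "'x topology \<Rightarrow> bool" where
  "Ramsey_space X \<longleftrightarrow>
     (\<forall>f. f \<in> [UNIV :: nat set]\<^bsup>2\<^esup> \<rightarrow> topspace X \<longrightarrow>
       (\<exists>D x. infinite D \<and> x \<in> topspace X \<and>
         (\<forall>U. openin X U \<and> x \<in> U \<longrightarrow> (\<exists>K. finite K \<and> f ` [D - K]\<^bsup>2\<^esup> \<subseteq> U))))"

definition differentially_compact_space :: "'x topology \<Rightarrow> bool" where
  "differentially_compact_space X \<longleftrightarrow>
     (\<forall>f. f \<in> UNIV \<rightarrow> topspace X \<longrightarrow>
       (\<exists>D x. infinite D \<and> x \<in> topspace X \<and>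
         (\<forall>U. openin X U \<and> x \<in> U \<longrightarrow> (\<exists>K. finite K \<and> f ` Delta (D - K) \<subseteq> U))))"

definition FinBW :: "'a set \<Rightarrow> 'a set set \<Rightarrow> 'x topology set" where
  "FinBW \<Lambda> \<I> =
     {X. \<forall>f. f \<in> \<Lambda> \<rightarrow> topspace X \<longrightarrow>
       (\<exists>A\<in>positive_sets \<Lambda> \<I>. \<exists>x\<in>topspace X.
         \<forall>U. openin X U \<and> x \<in> U \<longrightarrow> finite {a \<in> A. f a \<notin> U})}"

definition almost_disjoint_family :: "'a set \<Rightarrow> 'a set set \<Rightarrow> bool" where
  "almost_disjoint_family \<Lambda> \<A> \<longleftrightarrow>
     (\<forall>A\<in>\<A>. A \<subseteq> \<Lambda> \<and> infinite A) \<and>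
     (\<forall>A\<in>\<A>. \<forall>B\<in>\<A>. A \<noteq> B \<longrightarrow> finite (A \<inter> B))"

text \<open>The underlying set \<open>\<Lambda> \<union> \<A>\<close> is a disjoint union, hence the sum type. A set is open iff it
  contains a basic neighbourhood of each of its points; for the isolated points of \<open>\<Lambda>\<close> this is
  no condition.\<close>

definition Psi :: "'a set \<Rightarrow> 'a set set \<Rightarrow> ('a + 'a set) topology" where
  "Psi \<Lambda> \<A> = topology (\<lambda>U. U \<subseteq> Inl ` \<Lambda> \<union> Inr ` \<A> \<and>
     (\<forall>A\<in>\<A>. Inr A \<in> U \<longrightarrow> (\<exists>F. finite F \<and> insert (Inr A) (Inl ` (A - F)) \<subseteq> U)))"

lemma openin_Psi:
  "openin (Psi \<Lambda> \<A>) U \<longleftrightarrow> U \<subseteq> Inl ` \<Lambda> \<union> Inr ` \<A> \<and>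
     (\<forall>A\<in>\<A>. Inr A \<in> U \<longrightarrow> (\<exists>F. finite F \<and> insert (Inr A) (Inl ` (A - F)) \<subseteq> U))"
proof -
  let ?P = "\<lambda>U. U \<subseteq> Inl ` \<Lambda> \<union> Inr ` \<A> \<and>
     (\<forall>A\<in>\<A>. Inr A \<in> U \<longrightarrow> (\<exists>F. finite F \<and> insert (Inr A) (Inl ` (A - F)) \<subseteq> U))"
  have 1: "?P (S \<inter> T)" if S: "?P S" and T: "?P T" for S T
  proof (intro conjI ballI impI)
    show "S \<inter> T \<subseteq> Inl ` \<Lambda> \<union> Inr ` \<A>" using S by blast
  next
    fix A assume A: "A \<in> \<A>" "Inr A \<in> S \<inter> T"
    obtain F where F: "finite F" "insert (Inr A) (Inl ` (A - F)) \<subseteq> S" using S A by blast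
    obtain G where G: "finite G" "insert (Inr A) (Inl ` (A - G)) \<subseteq> T" using T A by blast
    have "finite (F \<union> G) \<and> insert (Inr A) (Inl ` (A - (F \<union> G))) \<subseteq> S \<inter> T"
      using F G by blast
    then show "\<exists>F. finite F \<and> insert (Inr A) (Inl ` (A - F)) \<subseteq> S \<inter> T" by blast
  qed
  have 2: "?P (\<Union>\<K>)" if K: "\<forall>K\<in>\<K>. ?P K" for \<K>
  proof (intro conjI ballI impI)
    show "\<Union>\<K> \<subseteq> Inl ` \<Lambda> \<union> Inr ` \<A>" using K by blast
  next
    fix A assume A: "A \<in> \<A>" "Inr A \<in> \<Union>\<K>"
    then obtain K where "K \<in> \<K>" "Inr A \<in> K" by blast
    moreover from this obtain F where "finite F" "insert (Inr A) (Inl ` (A - F)) \<subseteq> K"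
      using K A(1) by meson
    ultimately show "\<exists>F. finite F \<and> insert (Inr A) (Inl ` (A - F)) \<subseteq> \<Union>\<K>" by blast
  qed
  have "istopology ?P"
    unfolding istopology_def using 1 2 by blast
  then show ?thesis by (simp add: Psi_def topology_inverse')
qed

lemma topspace_Psi:
  assumes "almost_disjoint_family \<Lambda> \<A>"
  shows "topspace (Psi \<Lambda> \<A>) = Inl ` \<Lambda> \<union> Inr ` \<A>"
proof
  show "topspace (Psi \<Lambda> \<A>) \<subseteq> Inl ` \<Lambda> \<union> Inr ` \<A>"
    using openin_topspace[of "Psi \<Lambda> \<A>"] by (simp only: openin_Psi)
  have "insert (Inr A) (Inl ` (A - {})) \<subseteq> Inl ` \<Lambda> \<union> Inr ` \<A>" if "A \<in> \<A>" for A
    using assms that by (auto simp: almost_disjoint_family_def)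
  then have "openin (Psi \<Lambda> \<A>) (Inl ` \<Lambda> \<union> Inr ` \<A>)"
    unfolding openin_Psi by (meson finite.emptyI subset_refl)
  then show "Inl ` \<Lambda> \<union> Inr ` \<A> \<subseteq> topspace (Psi \<Lambda> \<A>)"
    by (rule openin_subset)
qed

definition Phi :: "'a set \<Rightarrow> 'a set set \<Rightarrow> ('a + 'a set) option topology" where
  "Phi \<Lambda> \<A> = Alexandroff_compactification (Psi \<Lambda> \<A>)"

end

theory Submission
  imports Defs
begin

text \<open>
  Let \<open>\<rho>\<close> be one of \<open>D \<mapsto> FS D\<close>, \<open>D \<mapsto> [D]\<^sup>2\<close> and \<open>D \<mapsto> Delta D\<close>, and let \<open>J\<close> be an ideal on \<open>\<omega>\<close>
  that is not Katetov below the ideal of sets containing no \<open>\<rho> D\<close>; that is, for every \<open>g\<close> into \<open>\<omega>\<close>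
  there is an infinite \<open>D\<close> with \<open>g ` \<rho> D \<in> J\<close>. Under CH, a recursion along a well-order with
  countable initial segments, over all pairs of a \<open>J\<close>-positive set \<open>B\<close> and a set \<open>C \<in> J\<close>, yields an
  almost disjoint family \<open>\<A> \<subseteq> J\<close> such that every positive set contains a member of \<open>\<A>\<close> and every
  set in \<open>J\<close> has infinite intersection with only countably many members. Since positive sets
  contain members of \<open>\<A>\<close>, and members are in \<open>J\<close>, the inclusion of the isolated points witnesses
  that \<open>Phi \<A>\<close> is not in \<open>FinBW J\<close>.

  Given \<open>f\<close> into \<open>Phi \<A>\<close>, choose \<open>D\<close> such that the isolated points in \<open>f ` \<rho> D\<close> form a set in \<open>J\<close>.
  Then only countably many members of \<open>\<A>\<close> matter, and \<open>f\<close> converges along any \<open>E\<close> with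
  \<open>\<rho> E \<subseteq> \<rho> D\<close> whose tails \<open>\<rho> (E - K)\<close>, \<open>K\<close> finite, decide the fibres of \<open>f\<close> and the preimages of
  these members. Such an \<open>E\<close> is obtained by choosing its elements one at a time along an
  ultrafilter, which for \<open>FS\<close> is idempotent as in the Galvin--Glazer proof of Hindman's theorem.

  For the summable ideal, \<open>D\<close> is chosen in the same way, such that each new value of \<open>g\<close>, and each
  new limit of \<open>g\<close> along the ultrafilter, either equals an older one or is very large.
\<close>

section \<open>Ultrafilters and idempotent filters\<close>

definition decides :: "'a filter \<Rightarrow> 'a set \<Rightarrow> bool" where
  "decides F S \<longleftrightarrow> (\<forall>\<^sub>F x in F. x \<in> S) \<or> (\<forall>\<^sub>F x in F. x \<notin> S)"

lemma decides_cong: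
  assumes "\<forall>\<^sub>F x in F. x \<in> S \<longleftrightarrow> x \<in> T"
  shows "decides F S \<longleftrightarrow> decides F T"
proof -
  have "\<forall>\<^sub>F x in F. x \<notin> S \<longleftrightarrow> x \<notin> T" using assms by simp
  with assms show ?thesis unfolding decides_def by (simp only: eventually_subst)
qed

lemma decides_vimage_finite:
  assumes "finite Z" "\<And>z. z \<in> Z \<Longrightarrow> decides F (f -` {z})"
  shows "decides F (f -` Z)"
proof (cases "\<exists>z\<in>Z. \<forall>\<^sub>F y in F. f y = z")
  case True
  then have "\<forall>\<^sub>F y in F. f y \<in> Z" by (auto elim: eventually_mono)
  then show ?thesis by (simp add: decides_def)
next
  case False
  then have "\<forall>\<^sub>F y in F. \<forall>z\<in>Z. f y \<noteq> z"
    using assms by (intro eventually_ball_finite) (auto simp: decides_def)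
  then have "\<forall>\<^sub>F y in F. f y \<notin> Z" by (rule eventually_mono) blast
  then show ?thesis by (simp add: decides_def)
qed

definition ultrafilter :: "'a filter \<Rightarrow> bool" where
  "ultrafilter F \<longleftrightarrow> F \<noteq> bot \<and> (\<forall>S. decides F S)"

lemma ultrafilter_imp_neq_bot: "ultrafilter p \<Longrightarrow> p \<noteq> bot"
  by (simp add: ultrafilter_def)

lemma ultrafilter_not_eventually:
  assumes "ultrafilter p" "\<not> eventually P p"
  shows "\<forall>\<^sub>F x in p. \<not> P x"
proof -
  have "decides p {x. P x}" using assms(1) by (simp add: ultrafilter_def)
  then show ?thesis using assms(2) by (simp add: decides_def)
qed

lemma ultrafilter_filtermap:
  assumes "ultrafilter p"
  shows "ultrafilter (filtermap f p)"
proof -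
  have "decides (filtermap f p) S" for S
    using ultrafilter_not_eventually[OF assms, of "\<lambda>x. f x \<in> S"]
    by (auto simp: decides_def eventually_filtermap)
  then show ?thesis
    using ultrafilter_imp_neq_bot[OF assms] by (simp add: ultrafilter_def filtermap_bot_iff)
qed

lemma eventually_Inf_chain:
  assumes "C \<noteq> {}" "Complete_Partial_Order.chain (\<le>) C"
  shows "eventually P (Inf C) \<longleftrightarrow> (\<exists>F\<in>C. eventually P F)"
  using assms(1)
  by (rule eventually_Inf_base) (metis chainD[OF assms(2)] inf_greatest order_refl)

lemma Inf_chain_neq_bot:
  fixes C :: "'a filter set"
  assumes "C \<noteq> {}" "Complete_Partial_Order.chain (\<le>) C" "\<And>F. F \<in> C \<Longrightarrow> F \<noteq> bot"
  shows "Inf C \<noteq> bot"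
  using eventually_Inf_chain[OF assms(1,2), of "\<lambda>_. False"] assms(3)
  by (metis eventually_False)

lemma minimal_filter_exists:
  fixes F :: "'a filter"
  assumes "Q F"
    and chain: "\<And>C. C \<noteq> {} \<Longrightarrow> Complete_Partial_Order.chain (\<le>) C \<Longrightarrow> (\<And>G. G \<in> C \<Longrightarrow> Q G) \<Longrightarrow> Q (Inf C)"
  obtains G where "G \<le> F" "Q G" "\<And>H. Q H \<Longrightarrow> H \<le> G \<Longrightarrow> H = G"
proof -
  define A where "A = {G. Q G \<and> G \<le> F}"
  have "\<exists>G\<in>A. \<forall>H\<in>A. H \<le> G \<longrightarrow> H = G"
  proof (rule predicate_Zorn)
    show "partial_order_on A (relation_of (\<lambda>G H. H \<le> G) A)"
      by (auto simp: partial_order_on_def preorder_on_def refl_on_def trans_def antisym_def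
          relation_of_def)
    fix C assume "C \<in> Chains (relation_of (\<lambda>G H. H \<le> G) A)"
    then have C: "Complete_Partial_Order.chain (\<le>) C" "C \<subseteq> A"
      by (auto simp: Chains_def relation_of_def Complete_Partial_Order.chain_def)
    show "\<exists>H\<in>A. \<forall>G\<in>C. H \<le> G"
    proof (cases "C = {}")
      case False
      then obtain G where "G \<in> C" by blast
      then have "Inf C \<le> F" using C(2) by (auto simp: A_def intro: Inf_lower2)
      moreover have "Q (Inf C)" using False C by (intro chain) (auto simp: A_def)
      ultimately show ?thesis by (auto simp: A_def intro: Inf_lower)
    qed (use assms(1) in \<open>auto simp: A_def\<close>)
  qed
  then obtain G where G: "G \<in> A" "\<And>H. H \<in> A \<Longrightarrow> H \<le> G \<Longrightarrow> H = G" by blast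
  show ?thesis
    by (rule that[of G]) (use G in \<open>auto simp: A_def intro: order_trans\<close>)
qed

lemma ultrafilter_exists:
  assumes "F \<noteq> bot"
  obtains p where "p \<le> F" "ultrafilter p"
proof -
  obtain p where p: "p \<le> F" "p \<noteq> bot" "\<And>G. G \<noteq> bot \<Longrightarrow> G \<le> p \<Longrightarrow> G = p"
    by (rule minimal_filter_exists[of "\<lambda>F. F \<noteq> bot", OF assms Inf_chain_neq_bot]) blast+
  have "decides p S" for S
  proof (cases "inf p (principal S) = bot")
    case True
    then have "\<forall>\<^sub>F x in p. x \<notin> S" by (simp add: eventually_inf_principal flip: eventually_False)
    then show ?thesis by (simp add: decides_def)
  next
    case False
    then have "inf p (principal S) = p" by (intro p(3)) auto
    then have "p \<le> principal S" by (simp add: le_iff_inf)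
    then show ?thesis by (simp add: decides_def le_principal)
  qed
  then show ?thesis using that p(1,2) by (simp add: ultrafilter_def)
qed

definition fubini_filter :: "'a filter \<Rightarrow> 'b filter \<Rightarrow> ('a \<times> 'b) filter" where
  "fubini_filter F G = Abs_filter (\<lambda>P. \<forall>\<^sub>F x in F. \<forall>\<^sub>F y in G. P (x, y))"

lemma eventually_fubini_filter:
  "eventually P (fubini_filter F G) \<longleftrightarrow> (\<forall>\<^sub>F x in F. \<forall>\<^sub>F y in G. P (x, y))"
proof -
  have "is_filter (\<lambda>P. \<forall>\<^sub>F x in F. \<forall>\<^sub>F y in G. P (x, y))"
    by unfold_locales (auto simp: eventually_conj_iff elim!: eventually_mono)
  then show ?thesis by (simp add: fubini_filter_def eventually_Abs_filter)
qed

lemma ultrafilter_fubini_filter: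
  assumes "ultrafilter p" "ultrafilter q"
  shows "ultrafilter (fubini_filter p q)"
proof -
  have "decides (fubini_filter p q) S" for S
  proof (cases "\<forall>\<^sub>F x in p. \<forall>\<^sub>F y in q. (x, y) \<in> S")
    case False
    then have "\<forall>\<^sub>F x in p. \<not> (\<forall>\<^sub>F y in q. (x, y) \<in> S)"
      by (rule ultrafilter_not_eventually[OF assms(1)])
    then have "\<forall>\<^sub>F x in p. \<forall>\<^sub>F y in q. (x, y) \<notin> S"
      by (rule eventually_mono) (rule ultrafilter_not_eventually[OF assms(2)])
    then show ?thesis by (simp add: decides_def eventually_fubini_filter)
  qed (simp add: decides_def eventually_fubini_filter)
  moreover have "fubini_filter p q \<noteq> bot"
    using ultrafilter_imp_neq_bot[OF assms(1)] ultrafilter_imp_neq_bot[OF assms(2)]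
    by (simp add: eventually_fubini_filter flip: eventually_False)
  ultimately show ?thesis by (simp add: ultrafilter_def)
qed

definition add_filter :: "'a::plus filter \<Rightarrow> 'a filter \<Rightarrow> 'a filter" where
  "add_filter F G = filtermap (\<lambda>(x, y). x + y) (fubini_filter F G)"

lemma eventually_add_filter:
  "eventually P (add_filter F G) \<longleftrightarrow> (\<forall>\<^sub>F x in F. \<forall>\<^sub>F y in G. P (x + y))"
  by (simp add: add_filter_def eventually_filtermap eventually_fubini_filter)

lemma add_filter_assoc:
  fixes F G H :: "'a::semigroup_add filter"
  shows "add_filter (add_filter F G) H = add_filter F (add_filter G H)"
  by (simp add: filter_eq_iff eventually_add_filter add.assoc)

lemma add_filter_mono:
  assumes "F \<le> F'" "G \<le> G'"
  shows "add_filter F G \<le> add_filter F' G'"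
proof (rule filter_leI)
  fix P assume "eventually P (add_filter F' G')"
  then have "\<forall>\<^sub>F x in F. \<forall>\<^sub>F y in G'. P (x + y)"
    using filter_leD[OF assms(1)] by (simp add: eventually_add_filter)
  then show "eventually P (add_filter F G)"
    unfolding eventually_add_filter by (rule eventually_mono) (rule filter_leD[OF assms(2)])
qed

lemma add_filter_neq_bot: "F \<noteq> bot \<Longrightarrow> G \<noteq> bot \<Longrightarrow> add_filter F G \<noteq> bot"
  by (simp add: eventually_add_filter flip: eventually_False)

text \<open>The ultrafilters finer than an idempotent filter form a closed subsemigroup of the
  Stone-Cech compactification.\<close>

definition idempotent_filter :: "'a::plus filter \<Rightarrow> bool" where
  "idempotent_filter F \<longleftrightarrow> add_filter F F \<le> F"

lemma idempotent_filterD: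
  "idempotent_filter F \<Longrightarrow> eventually P F \<Longrightarrow> \<forall>\<^sub>F x in F. \<forall>\<^sub>F y in F. P (x + y)"
  unfolding idempotent_filter_def by (drule filter_leD) (simp_all add: eventually_add_filter)

lemma idempotent_filter_translate:
  fixes F :: "'a::semigroup_add filter"
  assumes "idempotent_filter F" "\<forall>\<^sub>F y in F. P (s + y)"
  shows "\<forall>\<^sub>F x in F. \<forall>\<^sub>F y in F. P (s + x + y)"
  using idempotent_filterD[OF assms] by (simp add: add.assoc)

lemma idempotent_filter_Inf_chain:
  assumes "C \<noteq> {}" "Complete_Partial_Order.chain (\<le>) C" "\<And>F. F \<in> C \<Longrightarrow> idempotent_filter F"
  shows "idempotent_filter (Inf C)"
  unfolding idempotent_filter_def
proof (rule Inf_greatest)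
  fix F assume "F \<in> C"
  then have "add_filter (Inf C) (Inf C) \<le> add_filter F F" by (intro add_filter_mono Inf_lower)
  also have "\<dots> \<le> F" using assms(3)[OF \<open>F \<in> C\<close>] by (simp add: idempotent_filter_def)
  finally show "add_filter (Inf C) (Inf C) \<le> F" .
qed

definition stabilizer_filter :: "'a::plus filter \<Rightarrow> 'a filter" where
  "stabilizer_filter p = (INF P\<in>{P. eventually P p}. principal {x. \<forall>\<^sub>F y in p. P (x + y)})"

lemma le_stabilizer_filter_iff: "F \<le> stabilizer_filter p \<longleftrightarrow> add_filter F p \<le> p"
  by (simp add: stabilizer_filter_def le_INF_iff le_principal eventually_add_filter
      le_filter_def[of _ p])

lemma eventually_stabilizer_filter:
  "eventually Q (stabilizer_filter p) \<longleftrightarrow>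
     (\<exists>P. eventually P p \<and> (\<forall>x. (\<forall>\<^sub>F y in p. P (x + y)) \<longrightarrow> Q x))"
proof -
  have directed: "\<exists>R\<in>{P. eventually P p}. principal {x. \<forall>\<^sub>F y in p. R (x + y)} \<le>
      inf (principal {x. \<forall>\<^sub>F y in p. P (x + y)}) (principal {x. \<forall>\<^sub>F y in p. P' (x + y)})"
    if "P \<in> {P. eventually P p}" "P' \<in> {P. eventually P p}" for P P' :: "'a \<Rightarrow> bool"
    using that by (intro bexI[of _ "\<lambda>x. P x \<and> P' x"]) (auto simp: eventually_conj_iff)
  have "{P. eventually P p} \<noteq> {}" using eventually_True by blast
  then have "eventually Q (stabilizer_filter p) \<longleftrightarrow>
      (\<exists>P\<in>{P. eventually P p}. eventually Q (principal {x. \<forall>\<^sub>F y in p. P (x + y)}))"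
    unfolding stabilizer_filter_def by (rule eventually_INF_base) (rule directed)
  then show ?thesis by (simp add: eventually_principal)
qed

lemma inf_stabilizer_filter_neq_bot:
  assumes "ultrafilter p" "p \<le> add_filter F p"
  shows "inf F (stabilizer_filter p) \<noteq> bot"
proof
  assume "inf F (stabilizer_filter p) = bot"
  then have "\<forall>\<^sub>F _ in inf F (stabilizer_filter p). False" by simp
  then obtain Q P where "eventually Q F" "eventually P p"
    and disjoint: "\<And>x. Q x \<Longrightarrow> \<not> (\<forall>\<^sub>F y in p. P (x + y))"
    unfolding eventually_inf eventually_stabilizer_filter by blast
  have "\<forall>\<^sub>F x in F. \<forall>\<^sub>F y in p. \<not> P (x + y)"
    using \<open>eventually Q F\<close>
    by (rule eventually_mono) (rule ultrafilter_not_eventually[OF assms(1) disjoint])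
  then have "\<forall>\<^sub>F x in p. \<not> P x"
    using filter_leD[OF assms(2), of "\<lambda>x. \<not> P x"] by (simp add: eventually_add_filter)
  with \<open>eventually P p\<close> have "\<forall>\<^sub>F _ in p. False" by eventually_elim simp
  then show False using ultrafilter_imp_neq_bot[OF assms(1)] by simp
qed

text \<open>Papazyan's form of the Ellis--Numakura lemma: a minimal idempotent filter is an ultrafilter,
  so Zorn's lemma can be applied to filters and no topology on ultrafilters is needed.\<close>

lemma minimal_idempotent_filter_ultrafilter:
  fixes F :: "'a::semigroup_add filter"
  assumes "F \<noteq> bot" "idempotent_filter F"
    and minimal: "\<And>G. G \<noteq> bot \<Longrightarrow> idempotent_filter G \<Longrightarrow> G \<le> F \<Longrightarrow> G = F"
  shows "ultrafilter F"
proof -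
  obtain p where p: "p \<le> F" "ultrafilter p" using ultrafilter_exists[OF assms(1)] .
  have absorb: "add_filter F p \<le> F"
    using add_filter_mono[OF order_refl p(1), of F] assms(2)
    by (auto simp: idempotent_filter_def intro: order_trans)
  have sum_eq: "add_filter F p = F"
  proof (rule minimal[OF _ _ absorb])
    show "add_filter F p \<noteq> bot" by (intro add_filter_neq_bot assms(1) ultrafilter_imp_neq_bot p(2))
    have "add_filter (add_filter F p) (add_filter F p) \<le> add_filter F (add_filter F p)"
      by (rule add_filter_mono[OF absorb order_refl])
    also have "\<dots> \<le> add_filter F p"
      using add_filter_mono[of "add_filter F F" F p p] assms(2)
      by (simp add: idempotent_filter_def add_filter_assoc)
    finally show "idempotent_filter (add_filter F p)" by (simp add: idempotent_filter_def)
  qed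
  define H where "H = inf F (stabilizer_filter p)"
  have stab: "add_filter H p \<le> p" by (simp add: H_def flip: le_stabilizer_filter_iff)
  have "H = F"
  proof (rule minimal)
    show "H \<noteq> bot" unfolding H_def using p sum_eq by (intro inf_stabilizer_filter_neq_bot) auto
    have "add_filter (add_filter H H) p \<le> add_filter H p"
      unfolding add_filter_assoc by (rule add_filter_mono[OF order_refl stab])
    then have "add_filter H H \<le> stabilizer_filter p"
      using stab by (auto simp: le_stabilizer_filter_iff intro: order_trans)
    moreover have "add_filter H H \<le> add_filter F F" by (intro add_filter_mono) (simp_all add: H_def)
    ultimately show "idempotent_filter H"
      using assms(2) by (auto simp: idempotent_filter_def H_def intro: order_trans)
  qed (simp add: H_def)
  then have "F \<le> p" using stab sum_eq by simp
  then show ?thesis using p by (simp add: antisym)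
qed

lemma idempotent_ultrafilter_exists:
  fixes F :: "'a::semigroup_add filter"
  assumes "F \<noteq> bot" "idempotent_filter F"
  obtains p where "p \<le> F" "ultrafilter p" "idempotent_filter p"
proof -
  obtain p where "p \<le> F" and p: "p \<noteq> bot \<and> idempotent_filter p"
    and minimal: "\<And>G. G \<noteq> bot \<and> idempotent_filter G \<Longrightarrow> G \<le> p \<Longrightarrow> G = p"
  proof (rule minimal_filter_exists[of "\<lambda>F. F \<noteq> bot \<and> idempotent_filter F" F])
    show "Inf C \<noteq> bot \<and> idempotent_filter (Inf C)"
      if "C \<noteq> {}" "Complete_Partial_Order.chain (\<le>) C" "\<And>F. F \<in> C \<Longrightarrow> F \<noteq> bot \<and> idempotent_filter F"
      for C :: "'a filter set"
      using that by (intro conjI Inf_chain_neq_bot idempotent_filter_Inf_chain) auto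
  qed (use assms in auto)
  then show ?thesis using that minimal_idempotent_filter_ultrafilter[of p] by blast
qed

section \<open>Deciding countably many sets along tails\<close>

definition tail_filter :: "(nat set \<Rightarrow> 'l set) \<Rightarrow> nat set \<Rightarrow> 'l filter" where
  "tail_filter \<rho> D = (INF K\<in>{K. finite K}. principal (\<rho> (D - K)))"

lemma eventually_tail_filter:
  assumes "mono \<rho>"
  shows "eventually P (tail_filter \<rho> D) \<longleftrightarrow> (\<exists>K. finite K \<and> (\<forall>y\<in>\<rho> (D - K). P y))"
proof -
  have "eventually P (tail_filter \<rho> D) \<longleftrightarrow> (\<exists>K\<in>{K. finite K}. eventually P (principal (\<rho> (D - K))))"
    unfolding tail_filter_def
  proof (rule eventually_INF_base)
    fix K L :: "nat set" assume "K \<in> {K. finite K}" "L \<in> {K. finite K}"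
    moreover have "\<rho> (D - (K \<union> L)) \<subseteq> \<rho> (D - K)" "\<rho> (D - (K \<union> L)) \<subseteq> \<rho> (D - L)"
      by (intro monoD[OF assms]; blast)+
    ultimately show "\<exists>M\<in>{K. finite K}. principal (\<rho> (D - M)) \<le>
        inf (principal (\<rho> (D - K))) (principal (\<rho> (D - L)))"
      by (intro bexI[of _ "K \<union> L"]) auto
  qed blast
  then show ?thesis by (simp add: eventually_principal)
qed

lemma eventually_tail_filter_self:
  assumes "mono \<rho>"
  shows "\<forall>\<^sub>F y in tail_filter \<rho> D. y \<in> \<rho> D"
  unfolding eventually_tail_filter[OF assms] by (intro exI[of _ "{}"]) simp

lemma eventually_tail_filter_range:
  fixes n :: nat
  assumes "mono \<rho>" "inj x" "\<rho> (x ` {n..}) \<subseteq> T"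
  shows "\<forall>\<^sub>F y in tail_filter \<rho> (range x). y \<in> T"
proof -
  have "range x - x ` {..<n} = x ` {n..}"
    using image_set_diff[OF assms(2), of UNIV "{..<n}"]
    by (simp add: Compl_lessThan flip: Compl_eq_Diff_UNIV)
  then show ?thesis
    unfolding eventually_tail_filter[OF assms(1)]
    using assms(3) by (intro exI[of _ "x ` {..<n}"]) auto
qed

lemma tail_filter_image:
  assumes "mono \<rho>"
  shows "tail_filter (\<lambda>D. e ` \<rho> D) D = filtermap e (tail_filter \<rho> D)"
proof -
  have "mono (\<lambda>D. e ` \<rho> D)" using assms by (simp add: mono_def image_mono)
  then show ?thesis
    by (simp add: filter_eq_iff eventually_filtermap eventually_tail_filter assms)
qed

locale diagonally_Ramsey =
  fixes \<Lambda> :: "'l set" and \<rho> :: "nat set \<Rightarrow> 'l set"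
  assumes countable_carrier: "countable \<Lambda>"
    and subset_carrier: "\<rho> D \<subseteq> \<Lambda>"
    and mono: "mono \<rho>"
    and infinite_index: "infinite D \<Longrightarrow> infinite (\<rho> D)"
    and decide: "infinite D \<Longrightarrow> countable \<S> \<Longrightarrow>
      \<exists>E. infinite E \<and> \<rho> E \<subseteq> \<rho> D \<and> (\<forall>S\<in>\<S>. decides (tail_filter \<rho> E) S)"

lemma (in diagonally_Ramsey) decide_vimages:
  fixes f :: "'l \<Rightarrow> 'b"
  assumes "infinite D" "countable \<T>"
  obtains E where "infinite E" "\<rho> E \<subseteq> \<rho> D" "\<And>z. decides (tail_filter \<rho> E) (f -` {z})"
    "\<And>T. T \<in> \<T> \<Longrightarrow> decides (tail_filter \<rho> E) (f -` T)"
proof -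
  define \<S> where "\<S> = (\<lambda>z. f -` {z}) ` f ` \<Lambda> \<union> (-`) f ` \<T>"
  have "countable \<S>" using countable_carrier assms(2) by (simp add: \<S>_def)
  from decide[OF assms(1) this]
  obtain E where E: "infinite E" "\<rho> E \<subseteq> \<rho> D" "\<And>S. S \<in> \<S> \<Longrightarrow> decides (tail_filter \<rho> E) S" by blast
  have "decides (tail_filter \<rho> E) (f -` {z})" for z
  proof (cases "z \<in> f ` \<Lambda>")
    case False
    then have "\<forall>\<^sub>F y in tail_filter \<rho> E. f y \<noteq> z"
      using eventually_tail_filter_self[OF mono, of E] subset_carrier
      by (auto elim!: eventually_mono)
    then show ?thesis by (simp add: decides_def)
  qed (auto simp: \<S>_def intro!: E(3))
  moreover have "decides (tail_filter \<rho> E) (f -` T)" if "T \<in> \<T>" for T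
    using that by (intro E(3)) (auto simp: \<S>_def)
  ultimately show ?thesis using that E(1,2) by blast
qed

lemma diagonally_Ramsey_image:
  assumes "diagonally_Ramsey \<Lambda> \<rho>" "countable \<Lambda>'" "e ` \<Lambda> \<subseteq> \<Lambda>'"
    and "\<And>D. infinite D \<Longrightarrow> infinite (e ` \<rho> D)"
  shows "diagonally_Ramsey \<Lambda>' (\<lambda>D. e ` \<rho> D)"
proof -
  interpret diagonally_Ramsey \<Lambda> \<rho> by fact
  show ?thesis
  proof
    show "mono (\<lambda>D. e ` \<rho> D)" using mono by (simp add: mono_def image_mono)
    show "e ` \<rho> D \<subseteq> \<Lambda>'" for D using subset_carrier assms(3) by blast
    fix D :: "nat set" and \<S> :: "'b set set" assume "infinite D" "countable \<S>"
    then obtain E where "infinite E" "\<rho> E \<subseteq> \<rho> D" "\<forall>S\<in>(\<lambda>S. e -` S) ` \<S>. decides (tail_filter \<rho> E) S"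
      using decide by (metis countable_image)
    then show "\<exists>E. infinite E \<and> e ` \<rho> E \<subseteq> e ` \<rho> D \<and>
        (\<forall>S\<in>\<S>. decides (tail_filter (\<lambda>D. e ` \<rho> D) E) S)"
      by (intro exI[of _ E])
        (auto simp: decides_def tail_filter_image[OF mono] eventually_filtermap)
  qed (use assms in auto)
qed

definition diagonal_filter :: "(nat set \<Rightarrow> 'l set) \<Rightarrow> 'l filter \<Rightarrow> bool" where
  "diagonal_filter \<rho> q \<longleftrightarrow> (\<forall>T :: nat \<Rightarrow> 'l set. (\<forall>n. \<forall>\<^sub>F y in q. y \<in> T n) \<longrightarrow>
     (\<exists>x :: nat \<Rightarrow> nat. strict_mono x \<and> (\<forall>n. \<rho> (x ` {n..}) \<subseteq> T n)))"

lemma diagonally_RamseyI: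
  assumes "countable \<Lambda>" "\<And>D. \<rho> D \<subseteq> \<Lambda>" "mono \<rho>" "\<And>D. infinite D \<Longrightarrow> infinite (\<rho> D)"
    and diagonal: "\<And>D. infinite D \<Longrightarrow>
      \<exists>q. ultrafilter q \<and> diagonal_filter \<rho> q \<and> (\<forall>\<^sub>F y in q. y \<in> \<rho> D)"
  shows "diagonally_Ramsey \<Lambda> \<rho>"
proof
  fix D :: "nat set" and \<S> :: "'a set set"
  assume "infinite D" "countable \<S>"
  then obtain q where q: "ultrafilter q" "diagonal_filter \<rho> q" "\<forall>\<^sub>F y in q. y \<in> \<rho> D"
    using diagonal by blast
  define large where "large S = (if \<forall>\<^sub>F y in q. y \<in> S then S else - S)" for S
  have "\<forall>\<^sub>F y in q. y \<in> large S \<inter> \<rho> D" for S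
  proof -
    have "\<forall>\<^sub>F y in q. y \<in> large S"
      using ultrafilter_not_eventually[OF q(1), of "\<lambda>y. y \<in> S"] by (simp add: large_def)
    then show ?thesis using q(3) by eventually_elim simp
  qed
  then obtain x where x: "strict_mono x" "\<And>n. \<rho> (x ` {n..}) \<subseteq> large (from_nat_into \<S> n) \<inter> \<rho> D"
    using q(2)[unfolded diagonal_filter_def, rule_format, of "\<lambda>n. large (from_nat_into \<S> n) \<inter> \<rho> D"]
    by blast
  have inj: "inj x" using x(1) by (rule strict_mono_imp_inj_on)
  have "decides (tail_filter \<rho> (range x)) S" if "S \<in> \<S>" for S
  proof -
    have "\<forall>\<^sub>F y in tail_filter \<rho> (range x). y \<in> large S"
      using x(2)[of "to_nat_on \<S> S"] \<open>countable \<S>\<close> that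
      by (intro eventually_tail_filter_range[OF assms(3) inj]) auto
    then show ?thesis by (auto simp: large_def decides_def split: if_splits)
  qed
  moreover have "\<rho> (range x) \<subseteq> \<rho> D" using x(2)[of 0] by auto
  ultimately show "\<exists>E. infinite E \<and> \<rho> E \<subseteq> \<rho> D \<and> (\<forall>S\<in>\<S>. decides (tail_filter \<rho> E) S)"
    using range_inj_infinite[OF inj] by blast
qed (use assms in auto)

lemma strict_mono_sequence_along_filter:
  fixes F :: "nat filter" and R :: "(nat \<Rightarrow> nat) \<Rightarrow> nat \<Rightarrow> nat \<Rightarrow> bool"
  assumes "F \<noteq> bot" "F \<le> at_top"
    and initial: "\<And>x y n r. (\<And>i. i < n \<Longrightarrow> x i = y i) \<Longrightarrow> R x n r \<longleftrightarrow> R y n r"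
    and step: "\<And>x n. (\<And>i. i < n \<Longrightarrow> R x i (x i)) \<Longrightarrow> \<forall>\<^sub>F r in F. R x n r"
  obtains x where "strict_mono x" "\<And>n. R x n (x n)"
proof -
  have "\<exists>x. \<forall>n. R x n (x n) \<and> (\<forall>i<n. x i < x n)"
  proof (rule dependent_wf_choice[OF wf_less])
    fix x y :: "nat \<Rightarrow> nat" and n r assume "\<And>i. (i, n) \<in> {(x, y). x < y} \<Longrightarrow> x i = y i"
    then show "R x n r \<and> (\<forall>i<n. x i < r) \<longleftrightarrow> R y n r \<and> (\<forall>i<n. y i < r)"
      using initial[of n x y r] by auto
  next
    fix x n assume "\<And>i. (i, n) \<in> {(x, y). x < y} \<Longrightarrow> R x i (x i) \<and> (\<forall>j<i. x j < x i)"
    then have "\<forall>\<^sub>F r in F. R x n r" by (intro step) simp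
    moreover have "\<forall>\<^sub>F r in F. \<forall>i\<in>{..<n}. x i < r"
      by (intro eventually_ball_finite ballI filter_leD[OF assms(2) eventually_gt_at_top]) simp
    ultimately have "\<forall>\<^sub>F r in F. R x n r \<and> (\<forall>i<n. x i < r)" by eventually_elim simp
    then show "\<exists>r. R x n r \<and> (\<forall>i<n. x i < r)" by (rule eventually_happens'[OF assms(1)])
  qed
  then show ?thesis using that by (metis strict_monoI)
qed

section \<open>Finite sums\<close>

lemma FS_I: "finite K \<Longrightarrow> K \<noteq> {} \<Longrightarrow> K \<subseteq> D \<Longrightarrow> \<Sum>K \<in> FS D"
  unfolding FS_def by blast

lemma FS_E:
  assumes "s \<in> FS D"
  obtains K where "finite K" "K \<noteq> {}" "K \<subseteq> D" "s = \<Sum>K"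
  using assms by (auto simp: FS_def)

lemma mono_FS: "mono FS"
  by (rule monoI) (unfold FS_def, blast)

lemma subset_FS: "D \<subseteq> FS D"
  using FS_I[of "{_}" D] by auto

lemma FS_add:
  assumes "s \<in> FS D"
  obtains K where "finite K" "\<And>y. y \<in> FS (D - K) \<Longrightarrow> s + y \<in> FS D"
proof -
  obtain K where K: "finite K" "K \<noteq> {}" "K \<subseteq> D" "s = \<Sum>K" using assms by (rule FS_E)
  have "s + y \<in> FS D" if "y \<in> FS (D - K)" for y
  proof -
    obtain L where L: "finite L" "L \<subseteq> D - K" "y = \<Sum>L"
      using \<open>y \<in> FS (D - K)\<close> by (rule FS_E)
    then have "s + y = \<Sum>(K \<union> L)" using K by (subst sum.union_disjoint) auto
    then show ?thesis using FS_I[of "K \<union> L" D] K L by auto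
  qed
  then show ?thesis using that K(1) by blast
qed

lemma sum_Max_cases:
  fixes x :: "'a::linorder \<Rightarrow> 'b::comm_monoid_add"
  assumes "finite I"
  obtains "I = {}" | m J where "m \<in> I" "J \<subseteq> I \<inter> {..<m}" "sum x I = sum x J + x m"
proof (cases "I = {}")
  case False
  then have Max: "Max I \<in> I" using assms by simp
  moreover have "I - {Max I} \<subseteq> I \<inter> {..<Max I}"
    using assms by (auto simp: order.strict_iff_order)
  moreover have "sum x I = sum x (I - {Max I}) + x (Max I)"
    using sum.remove[OF assms Max, of x] by (simp add: add.commute)
  ultimately show ?thesis using that by blast
qed (use that in blast)

lemma FS_image_cases:
  fixes x :: "nat \<Rightarrow> nat"
  assumes "y \<in> FS (x ` A)" "inj x"
  obtains n I where "n \<in> A" "I \<subseteq> A \<inter> {..<n}" "y = sum x I + x n"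
proof -
  obtain J where J: "finite J" "J \<noteq> {}" "J \<subseteq> x ` A" "y = \<Sum>J" using assms(1) by (rule FS_E)
  then obtain I where I: "I \<subseteq> A" "J = x ` I" by (meson subset_imageE)
  have inj: "inj_on x I" using assms(2) by (rule inj_on_subset) simp
  have fin: "finite I" using J(1) I(2) finite_imageD[OF _ inj] by simp
  show ?thesis
  proof (cases rule: sum_Max_cases[OF fin, where x = x])
    case 1
    then show ?thesis using J(2) I(2) by simp
  next
    case (2 n K)
    have "y = sum x I" using J(4) I(2) by (simp add: sum.reindex[OF inj])
    then show ?thesis using that 2 I(1) by auto
  qed
qed

lemma tail_filter_FS_le_at_top: "tail_filter FS D \<le> at_top"
proof (rule filter_leI)
  fix P :: "nat \<Rightarrow> bool" assume "eventually P at_top"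
  then obtain m where m: "\<And>y. m \<le> y \<Longrightarrow> P y" by (auto simp: eventually_at_top_linorder)
  have "m \<le> y" if "y \<in> FS (D - {..<m})" for y
  proof -
    obtain K where K: "finite K" "K \<noteq> {}" "K \<subseteq> D - {..<m}" "y = \<Sum>K"
      using \<open>y \<in> FS (D - {..<m})\<close> by (rule FS_E)
    then obtain k where "k \<in> K" by blast
    then have "m \<le> k" "k \<le> y" using K by (auto intro: member_le_sum)
    then show ?thesis by simp
  qed
  then show "eventually P (tail_filter FS D)"
    unfolding eventually_tail_filter[OF mono_FS] using m finite_lessThan by blast
qed

lemma tail_filter_FS_neq_bot:
  assumes "infinite D"
  shows "tail_filter FS D \<noteq> bot"
proof -
  have "FS (D - K) \<noteq> {}" if "finite K" for K
    using subset_FS[of "D - K"] assms that by (metis finite.emptyI finite_Diff2 subset_empty)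
  then show ?thesis by (auto simp: eventually_tail_filter[OF mono_FS] simp flip: eventually_False)
qed

lemma idempotent_filter_tail_filter_FS: "idempotent_filter (tail_filter FS D)"
  unfolding idempotent_filter_def
proof (rule filter_leI)
  fix P assume "eventually P (tail_filter FS D)"
  then obtain K where K: "finite K" "\<And>y. y \<in> FS (D - K) \<Longrightarrow> P y"
    unfolding eventually_tail_filter[OF mono_FS] by blast
  have "\<forall>\<^sub>F y in tail_filter FS D. P (s + y)" if s: "s \<in> FS (D - K)" for s
  proof -
    obtain L where L: "finite L" "\<And>y. y \<in> FS (D - K - L) \<Longrightarrow> s + y \<in> FS (D - K)"
      using FS_add[OF s] by blast
    moreover have "D - (K \<union> L) = D - K - L" by blast
    ultimately show ?thesis
      unfolding eventually_tail_filter[OF mono_FS] using K by (intro exI[of _ "K \<union> L"]) simp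
  qed
  then show "eventually P (add_filter (tail_filter FS D) (tail_filter FS D))"
    unfolding eventually_add_filter
    using K(1) by (subst eventually_tail_filter[OF mono_FS]) blast
qed

lemma idempotent_ultrafilter_FS_exists:
  assumes "infinite D"
  obtains p where "ultrafilter p" "idempotent_filter p" "p \<le> at_top" "\<forall>\<^sub>F y in p. y \<in> FS D"
proof -
  obtain p where p: "p \<le> tail_filter FS D" "ultrafilter p" "idempotent_filter p"
    using idempotent_ultrafilter_exists[OF tail_filter_FS_neq_bot[OF assms]
        idempotent_filter_tail_filter_FS] by blast
  moreover have "p \<le> at_top" using p(1) tail_filter_FS_le_at_top by (rule order_trans)
  moreover have "\<forall>\<^sub>F y in p. y \<in> FS D"
    using eventually_tail_filter_self[OF mono_FS] by (rule filter_leD[OF p(1)])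
  ultimately show ?thesis using that by blast
qed

text \<open>The Galvin--Glazer argument, run against countably many sets at once.\<close>

lemma diagonal_filter_FS:
  fixes p :: "nat filter"
  assumes "p \<noteq> bot" "p \<le> at_top" "idempotent_filter p"
  shows "diagonal_filter FS p"
  unfolding diagonal_filter_def
proof (intro allI impI)
  fix T :: "nat \<Rightarrow> nat set" assume T: "\<forall>n. \<forall>\<^sub>F y in p. y \<in> T n"
  define good where "good k s \<longleftrightarrow> s \<in> T k \<and> (\<forall>\<^sub>F y in p. s + y \<in> T k)" for k s
  have eventually_good: "\<forall>\<^sub>F r in p. good k (s + r)" if "\<forall>\<^sub>F y in p. s + y \<in> T k" for k s
    using that idempotent_filter_translate[OF assms(3) that] unfolding good_def
    by (rule eventually_conj)
  define R where "R x n r \<longleftrightarrow> (\<forall>k\<in>{..n}. \<forall>I\<in>Pow {k..<n}. good k (sum x I + r))" for x n r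
  obtain x where x: "strict_mono x" "\<And>n. R x n (x n)"
  proof (rule strict_mono_sequence_along_filter[OF assms(1,2), of R])
    fix x y :: "nat \<Rightarrow> nat" and n r assume "\<And>i. i < n \<Longrightarrow> x i = y i"
    then have "sum x I = sum y I" if "I \<in> Pow {k..<n}" for k I
      using that by (intro sum.cong) auto
    then show "R x n r \<longleftrightarrow> R y n r" by (simp add: R_def)
  next
    fix x n assume R: "\<And>i. i < n \<Longrightarrow> R x i (x i)"
    have "\<forall>\<^sub>F y in p. sum x I + y \<in> T k" if I: "I \<subseteq> {k..<n}" for k I
    proof (cases rule: sum_Max_cases[OF finite_subset[OF I finite_atLeastLessThan], where x = x])
      case (2 m J)
      then have "m < n" "k \<in> {..m}" "J \<in> Pow {k..<m}" using I by (auto simp: subset_eq)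
      then have "good k (sum x J + x m)" using R[of m] unfolding R_def by blast
      then show ?thesis using 2 by (simp add: good_def)
    qed (use T in simp)
    then show "\<forall>\<^sub>F r in p. R x n r"
      unfolding R_def by (intro eventually_ball_finite ballI eventually_good) auto
  qed blast
  have "y \<in> T k" if y: "y \<in> FS (x ` {k..})" for k y
  proof -
    obtain n I where "n \<in> {k..}" "I \<subseteq> {k..} \<inter> {..<n}" "y = sum x I + x n"
      using FS_image_cases[OF y strict_mono_imp_inj_on[OF x(1)]] .
    moreover from this have "I \<in> Pow {k..<n}" by auto
    ultimately show ?thesis using x(2)[of n] by (simp add: R_def good_def)
  qed
  then show "\<exists>x. strict_mono x \<and> (\<forall>k. FS (x ` {k..}) \<subseteq> T k)" using x(1) by blast
qed

lemma diagonally_Ramsey_FS: "diagonally_Ramsey UNIV FS"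
proof (rule diagonally_RamseyI)
  fix D :: "nat set" assume "infinite D"
  then show "infinite (FS D)" using subset_FS finite_subset by blast
  obtain p where "ultrafilter p" "idempotent_filter p" "p \<le> at_top" "\<forall>\<^sub>F y in p. y \<in> FS D"
    using idempotent_ultrafilter_FS_exists[OF \<open>infinite D\<close>] .
  then show "\<exists>q. ultrafilter q \<and> diagonal_filter FS q \<and> (\<forall>\<^sub>F y in q. y \<in> FS D)"
    using diagonal_filter_FS ultrafilter_imp_neq_bot by blast
qed (simp_all add: mono_FS)

section \<open>Pairs and differences\<close>

lemma free_ultrafilter_exists:
  fixes D :: "nat set"
  assumes "infinite D"
  obtains p where "ultrafilter p" "p \<le> at_top" "\<forall>\<^sub>F x in p. x \<in> D"
proof -
  have "inf at_top (principal D) \<noteq> bot"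
  proof
    assume "inf at_top (principal D) = bot"
    then have "\<forall>\<^sub>F x in at_top. x \<notin> D"
      by (simp add: eventually_inf_principal flip: eventually_False)
    then show False using assms by (simp add: eventually_cofinite flip: cofinite_eq_sequentially)
  qed
  then obtain p where "p \<le> inf at_top (principal D)" "ultrafilter p" by (rule ultrafilter_exists)
  then show ?thesis using that by (simp add: le_principal)
qed

definition pair_filter :: "nat filter \<Rightarrow> nat set filter" where
  "pair_filter p = filtermap (\<lambda>(a, b). {a, b}) (fubini_filter p p)"

lemma eventually_pair_filter:
  "eventually P (pair_filter p) \<longleftrightarrow> (\<forall>\<^sub>F a in p. \<forall>\<^sub>F b in p. P {a, b})"
  by (simp add: pair_filter_def eventually_filtermap eventually_fubini_filter)

lemma nsets_2_image_cases:
  fixes x :: "'a::linorder \<Rightarrow> 'b"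
  assumes "e \<in> [x ` A]\<^bsup>2\<^esup>"
  obtains i j where "i \<in> A" "j \<in> A" "i < j" "e = {x i, x j}"
proof -
  obtain i j where "i \<in> A" "j \<in> A" "i \<noteq> j" "e = {x i, x j}" using assms by (elim nsets2_E) blast
  then show ?thesis using that[of i j] that[of j i] by (cases i j rule: linorder_cases) auto
qed

lemma diagonal_filter_nsets_2:
  fixes p :: "nat filter"
  assumes "p \<noteq> bot" "p \<le> at_top"
  shows "diagonal_filter (\<lambda>D. [D]\<^bsup>2\<^esup>) (pair_filter p)"
  unfolding diagonal_filter_def
proof (intro allI impI)
  fix T :: "nat \<Rightarrow> nat set set" assume "\<forall>n. \<forall>\<^sub>F e in pair_filter p. e \<in> T n"
  then have T: "\<forall>\<^sub>F a in p. \<forall>\<^sub>F b in p. {a, b} \<in> T n" for n by (simp add: eventually_pair_filter)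
  define R where "R x n r \<longleftrightarrow> (\<forall>k\<in>{..n}. \<forall>\<^sub>F b in p. {r, b} \<in> T k) \<and>
      (\<forall>i\<in>{..<n}. \<forall>k\<in>{..i}. {x i, r} \<in> T k)" for x n r
  obtain x where x: "strict_mono x" "\<And>n. R x n (x n)"
  proof (rule strict_mono_sequence_along_filter[OF assms, of R])
    fix x n assume "\<And>i. i < n \<Longrightarrow> R x i (x i)"
    then show "\<forall>\<^sub>F r in p. R x n r"
      unfolding R_def by (intro eventually_conj eventually_ball_finite ballI T) auto
  qed (auto simp: R_def)
  have "e \<in> T k" if e: "e \<in> [x ` {k..}]\<^bsup>2\<^esup>" for k e
  proof -
    obtain i j where "i \<in> {k..}" "i < j" "e = {x i, x j}"
      using nsets_2_image_cases[OF e] by metis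
    then show ?thesis using x(2)[of j] by (simp add: R_def)
  qed
  then show "\<exists>x. strict_mono x \<and> (\<forall>k. [x ` {k..}]\<^bsup>2\<^esup> \<subseteq> T k)" using x(1) by blast
qed

lemma mono_nsets: "mono (\<lambda>D. [D]\<^bsup>n\<^esup>)"
  by (intro monoI nsets_mono)

lemma diagonally_Ramsey_nsets_2: "diagonally_Ramsey ([UNIV]\<^bsup>2\<^esup>) (\<lambda>D. [D]\<^bsup>2\<^esup>)"
proof (rule diagonally_RamseyI)
  show "countable ([UNIV :: nat set]\<^bsup>2\<^esup>)"
    by (rule countable_subset[OF _ countable_Collect_finite]) (auto simp: nsets_def)
  fix D :: "nat set" assume "infinite D"
  then show "infinite ([D]\<^bsup>2\<^esup>)" by (simp add: infinite_imp_infinite_nsets)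
  obtain p where p: "ultrafilter p" "p \<le> at_top" "\<forall>\<^sub>F x in p. x \<in> D"
    using free_ultrafilter_exists[OF \<open>infinite D\<close>] .
  have "\<forall>\<^sub>F e in pair_filter p. e \<in> [D]\<^bsup>2\<^esup>"
    unfolding eventually_pair_filter using p(3)
  proof eventually_elim
    case (elim a)
    show ?case
      using p(3) filter_leD[OF p(2) eventually_gt_at_top[of a]]
      by (rule eventually_elim2) (use elim in simp)
  qed
  moreover have "ultrafilter (pair_filter p)"
    unfolding pair_filter_def by (intro ultrafilter_filtermap ultrafilter_fubini_filter p(1))
  ultimately show "\<exists>q. ultrafilter q \<and> diagonal_filter (\<lambda>D. [D]\<^bsup>2\<^esup>) q \<and> (\<forall>\<^sub>F e in q. e \<in> [D]\<^bsup>2\<^esup>)"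
    using diagonal_filter_nsets_2 p(1,2) ultrafilter_imp_neq_bot by blast
qed (simp_all add: mono_nsets nsets_mono)

lemma Delta_eq_image_nsets_2: "Delta D = (\<lambda>e. Max e - Min e) ` [D]\<^bsup>2\<^esup>"
proof
  show "Delta D \<subseteq> (\<lambda>e. Max e - Min e) ` [D]\<^bsup>2\<^esup>"
  proof
    fix d assume "d \<in> Delta D"
    then obtain a b where "a \<in> D" "b \<in> D" "b < a" "d = a - b" unfolding Delta_def by blast
    then show "d \<in> (\<lambda>e. Max e - Min e) ` [D]\<^bsup>2\<^esup>" by (intro image_eqI[of _ _ "{a, b}"]) auto
  qed
  show "(\<lambda>e. Max e - Min e) ` [D]\<^bsup>2\<^esup> \<subseteq> Delta D"
  proof clarify
    fix e assume "e \<in> [D]\<^bsup>2\<^esup>"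
    then obtain a b where "a \<in> D" "b \<in> D" "a < b" "e = {a, b}"
      using nsets_2_image_cases[of e id D] by auto
    then show "Max e - Min e \<in> Delta D" unfolding Delta_def by (auto simp: max_def min_def)
  qed
qed

lemma mono_Delta: "mono Delta"
  by (rule monoI) (unfold Delta_def, blast)

lemma infinite_Delta:
  assumes "infinite D"
  shows "infinite (Delta D)"
proof -
  obtain b where "b \<in> D" using infinite_imp_nonempty[OF assms] by blast
  then have "(\<lambda>a. a - b) ` (D - {..b}) \<subseteq> Delta D" by (force simp: Delta_def)
  moreover have "inj_on (\<lambda>a. a - b) (D - {..b})" by (auto simp: inj_on_def)
  then have "infinite ((\<lambda>a. a - b) ` (D - {..b}))" using assms by (simp add: finite_image_iff)
  ultimately show ?thesis using finite_subset by blast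
qed

lemma diagonally_Ramsey_Delta: "diagonally_Ramsey UNIV Delta"
  using diagonally_Ramsey_image[OF diagonally_Ramsey_nsets_2, of UNIV "\<lambda>e. Max e - Min e"]
    infinite_Delta by (simp flip: Delta_eq_image_nsets_2)

section \<open>Ideals and the Katetov order\<close>

lemma ideal_on_subset: "ideal_on \<Lambda> \<I> \<Longrightarrow> A \<in> \<I> \<Longrightarrow> B \<subseteq> A \<Longrightarrow> B \<in> \<I>"
  unfolding ideal_on_def by blast

lemma ideal_on_Un: "ideal_on \<Lambda> \<I> \<Longrightarrow> A \<in> \<I> \<Longrightarrow> B \<in> \<I> \<Longrightarrow> A \<union> B \<in> \<I>"
  unfolding ideal_on_def by blast

lemma ideal_on_finite: "ideal_on \<Lambda> \<I> \<Longrightarrow> finite F \<Longrightarrow> F \<subseteq> \<Lambda> \<Longrightarrow> F \<in> \<I>"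
  unfolding ideal_on_def by blast

lemma ideal_on_nonempty: "ideal_on \<Lambda> \<I> \<Longrightarrow> \<Lambda> \<noteq> {}"
  using ideal_on_finite[of \<Lambda> \<I> "{}"] by (auto simp: ideal_on_def)

lemma ideal_on_UN:
  assumes "ideal_on \<Lambda> \<I>" "finite I" "\<And>i. i \<in> I \<Longrightarrow> A i \<in> \<I>"
  shows "(\<Union>i\<in>I. A i) \<in> \<I>"
  using assms(2,3)
  by (induction I rule: finite_induct)
    (use ideal_on_Un[OF assms(1)] ideal_on_finite[OF assms(1)] in auto)

lemma katetov_le_trans:
  assumes "katetov_le \<Lambda>3 \<I>3 \<Lambda>2 \<I>2" "katetov_le \<Lambda>2 \<I>2 \<Lambda>1 \<I>1"
  shows "katetov_le \<Lambda>3 \<I>3 \<Lambda>1 \<I>1"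
proof -
  obtain \<phi> where \<phi>: "\<phi> \<in> \<Lambda>2 \<rightarrow> \<Lambda>3" "\<And>A. A \<subseteq> \<Lambda>2 \<Longrightarrow> A \<notin> \<I>2 \<Longrightarrow> \<phi> ` A \<notin> \<I>3"
    using assms(1) unfolding katetov_le_def by blast
  obtain \<psi> where \<psi>: "\<psi> \<in> \<Lambda>1 \<rightarrow> \<Lambda>2" "\<And>A. A \<subseteq> \<Lambda>1 \<Longrightarrow> A \<notin> \<I>1 \<Longrightarrow> \<psi> ` A \<notin> \<I>2"
    using assms(2) unfolding katetov_le_def by blast
  have "(\<phi> \<circ> \<psi>) ` A \<notin> \<I>3" if "A \<subseteq> \<Lambda>1" "A \<notin> \<I>1" for A
  proof -
    have "\<psi> ` A \<subseteq> \<Lambda>2" using \<psi>(1) that(1) by blast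
    from \<phi>(2)[OF this \<psi>(2)[OF that]] show ?thesis unfolding image_comp .
  qed
  moreover have "\<phi> \<circ> \<psi> \<in> \<Lambda>1 \<rightarrow> \<Lambda>3" using \<phi>(1) \<psi>(1) by auto
  ultimately show ?thesis unfolding katetov_le_def by blast
qed

lemma FinBW_antimono:
  assumes "katetov_le \<Lambda>2 \<I>2 \<Lambda>1 \<I>1"
  shows "FinBW \<Lambda>1 \<I>1 \<subseteq> FinBW \<Lambda>2 \<I>2"
proof
  fix X :: "'c topology" assume X: "X \<in> FinBW \<Lambda>1 \<I>1"
  obtain \<phi> where \<phi>: "\<phi> \<in> \<Lambda>1 \<rightarrow> \<Lambda>2" "\<And>A. A \<subseteq> \<Lambda>1 \<Longrightarrow> A \<notin> \<I>1 \<Longrightarrow> \<phi> ` A \<notin> \<I>2"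
    using assms unfolding katetov_le_def by blast
  show "X \<in> FinBW \<Lambda>2 \<I>2"
    unfolding FinBW_def mem_Collect_eq
  proof (intro allI impI)
    fix f assume "f \<in> \<Lambda>2 \<rightarrow> topspace X"
    then have "f \<circ> \<phi> \<in> \<Lambda>1 \<rightarrow> topspace X" using \<phi>(1) by auto
    from X[unfolded FinBW_def mem_Collect_eq, rule_format, OF this]
    obtain A x where A: "A \<in> positive_sets \<Lambda>1 \<I>1" and x: "x \<in> topspace X"
      and lim: "\<And>U. openin X U \<Longrightarrow> x \<in> U \<Longrightarrow> finite {a \<in> A. (f \<circ> \<phi>) a \<notin> U}"
      by blast
    have "\<phi> ` A \<in> positive_sets \<Lambda>2 \<I>2" using A \<phi> by (auto simp: positive_sets_def)
    moreover have "finite {b \<in> \<phi> ` A. f b \<notin> U}" if "openin X U" "x \<in> U" for U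
    proof -
      have "{b \<in> \<phi> ` A. f b \<notin> U} = \<phi> ` {a \<in> A. (f \<circ> \<phi>) a \<notin> U}" by auto
      then show ?thesis using lim[OF that] by simp
    qed
    ultimately show "\<exists>A\<in>positive_sets \<Lambda>2 \<I>2. \<exists>x\<in>topspace X.
        \<forall>U. openin X U \<and> x \<in> U \<longrightarrow> finite {a \<in> A. f a \<notin> U}"
      using x by blast
  qed
qed

lemma ideal_on_nat_equivalent:
  assumes "countable \<Lambda>" "ideal_on \<Lambda> \<I>"
  obtains J :: "nat set set"
  where "ideal_on UNIV J" "katetov_le \<Lambda> \<I> UNIV J" "katetov_le UNIV J \<Lambda> \<I>"
proof -
  define c where "c = from_nat_into \<Lambda>"
  have range_c: "range c = \<Lambda>"
    unfolding c_def using ideal_on_nonempty[OF assms(2)] assms(1) by (rule range_from_nat_into)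
  define J where "J = {S. c ` S \<in> \<I>}"
  have "ideal_on UNIV J"
    unfolding ideal_on_def
  proof (intro conjI ballI allI impI)
    show "B \<in> J" if "A \<in> J" "B \<subseteq> A" for A B
      using that ideal_on_subset[OF assms(2) _ image_mono] by (auto simp: J_def)
    show "A \<union> B \<in> J" if "A \<in> J" "B \<in> J" for A B
      using that ideal_on_Un[OF assms(2)] by (simp add: J_def image_Un)
    show finite_J: "F \<in> J" if "finite F \<and> F \<subseteq> UNIV" for F
      using that range_c by (auto simp: J_def intro!: ideal_on_finite[OF assms(2)])
    show "J \<noteq> {}" using finite_J[of "{}"] by auto
    show "UNIV \<notin> J" using assms(2) by (simp add: J_def range_c ideal_on_def)
  qed simp
  moreover have "katetov_le \<Lambda> \<I> UNIV J"
    unfolding katetov_le_def using range_c by (intro exI[of _ c]) (auto simp: J_def)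
  moreover have "katetov_le UNIV J \<Lambda> \<I>"
  proof -
    have "c ` inv_into UNIV c ` A = A" if "A \<subseteq> \<Lambda>" for A
      using that range_c by (simp add: image_inv_into_cancel)
    then show ?thesis
      unfolding katetov_le_def by (intro exI[of _ "inv_into UNIV c"]) (simp add: J_def)
  qed
  ultimately show ?thesis by (rule that)
qed

section \<open>Ideals and spaces indexed by infinite sets\<close>

definition indexed_ideal :: "'l set \<Rightarrow> (nat set \<Rightarrow> 'l set) \<Rightarrow> 'l set set" where
  "indexed_ideal \<Lambda> \<rho> = {A. A \<subseteq> \<Lambda> \<and> (\<forall>D. infinite D \<longrightarrow> \<not> \<rho> D \<subseteq> A)}"

lemma Hindman_ideal_eq: "Hindman_ideal = indexed_ideal UNIV FS"
  by (simp add: Hindman_ideal_def indexed_ideal_def)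

lemma Ramsey_ideal_eq: "Ramsey_ideal = indexed_ideal ([UNIV]\<^bsup>2\<^esup>) (\<lambda>D. [D]\<^bsup>2\<^esup>)"
  by (simp add: Ramsey_ideal_def indexed_ideal_def)

lemma Delta_ideal_eq: "Delta_ideal = indexed_ideal UNIV Delta"
  by (simp add: Delta_ideal_def indexed_ideal_def)

lemma not_katetov_le_indexed_ideal_iff:
  assumes "ideal_on \<Lambda>' \<I>" "\<And>D. \<rho> D \<subseteq> \<Lambda>"
  shows "\<not> katetov_le \<Lambda>' \<I> \<Lambda> (indexed_ideal \<Lambda> \<rho>) \<longleftrightarrow>
    (\<forall>\<phi> \<in> \<Lambda> \<rightarrow> \<Lambda>'. \<exists>D. infinite D \<and> \<phi> ` \<rho> D \<in> \<I>)"
proof -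
  have "(\<exists>A. (A \<subseteq> \<Lambda> \<and> A \<notin> indexed_ideal \<Lambda> \<rho>) \<and> \<phi> ` A \<in> \<I>) \<longleftrightarrow> (\<exists>D. infinite D \<and> \<phi> ` \<rho> D \<in> \<I>)"
    (is "?L \<longleftrightarrow> ?R") for \<phi>
  proof
    assume ?L
    then obtain A D where "\<phi> ` A \<in> \<I>" "infinite D" "\<rho> D \<subseteq> A" by (auto simp: indexed_ideal_def)
    then show ?R using ideal_on_subset[OF assms(1) _ image_mono] by blast
  next
    assume ?R
    then obtain D where "infinite D" "\<phi> ` \<rho> D \<in> \<I>" by blast
    then show ?L using assms(2) by (intro exI[of _ "\<rho> D"]) (auto simp: indexed_ideal_def)
  qed
  then show ?thesis unfolding katetov_le_def by blast
qed

lemma FinBW_iff: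
  "X \<in> FinBW \<Lambda> \<I> \<longleftrightarrow> (\<forall>f \<in> \<Lambda> \<rightarrow> topspace X. \<exists>A\<in>positive_sets \<Lambda> \<I>.
     \<exists>x. limitin X f x (inf cofinite (principal A)))"
  by (simp add: FinBW_def limitin_def eventually_inf_principal eventually_cofinite Bex_def Ball_def)

definition FinBW_indexed :: "'l set \<Rightarrow> (nat set \<Rightarrow> 'l set) \<Rightarrow> 'x topology set" where
  "FinBW_indexed \<Lambda> \<rho> =
     {X. \<forall>f \<in> \<Lambda> \<rightarrow> topspace X. \<exists>D x. infinite D \<and> limitin X f x (tail_filter \<rho> D)}"

lemma FinBW_indexed_iff:
  assumes "mono \<rho>"
  shows "X \<in> FinBW_indexed \<Lambda> \<rho> \<longleftrightarrow>
    (\<forall>f. f \<in> \<Lambda> \<rightarrow> topspace X \<longrightarrow> (\<exists>D x. infinite D \<and> x \<in> topspace X \<and>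
       (\<forall>U. openin X U \<and> x \<in> U \<longrightarrow> (\<exists>K. finite K \<and> f ` \<rho> (D - K) \<subseteq> U))))"
  by (simp add: FinBW_indexed_def limitin_def eventually_tail_filter[OF assms] image_subset_iff
      Ball_def)

lemma Hindman_space_iff: "Hindman_space X \<longleftrightarrow> X \<in> FinBW_indexed UNIV FS"
  by (simp only: Hindman_space_def FinBW_indexed_iff[OF mono_FS])

lemma Ramsey_space_iff: "Ramsey_space X \<longleftrightarrow> X \<in> FinBW_indexed ([UNIV]\<^bsup>2\<^esup>) (\<lambda>D. [D]\<^bsup>2\<^esup>)"
  by (simp only: Ramsey_space_def FinBW_indexed_iff[OF mono_nsets])

lemma differentially_compact_space_iff:
  "differentially_compact_space X \<longleftrightarrow> X \<in> FinBW_indexed UNIV Delta"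
  by (simp only: differentially_compact_space_def FinBW_indexed_iff[OF mono_Delta])

section \<open>The summable ideal\<close>

lemma ideal_on_summable_ideal: "ideal_on UNIV summable_ideal"
  unfolding ideal_on_def
proof (intro conjI ballI allI impI)
  let ?w = "\<lambda>v. 1 / (real v + 1)"
  show "summable_ideal \<noteq> {}" by (auto simp: summable_ideal_def intro: exI[of _ "{}"])
  show "B \<in> summable_ideal" if "A \<in> summable_ideal" "B \<subseteq> A" for A B
    using that summable_on_subset_banach by (auto simp: summable_ideal_def)
  show "A \<union> B \<in> summable_ideal" if "A \<in> summable_ideal" "B \<in> summable_ideal" for A B
  proof -
    have "?w summable_on (A \<union> (B - A))"
      using that summable_on_subset_banach[of ?w B "B - A"]
      by (intro summable_on_Un_disjoint) (auto simp: summable_ideal_def)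
    then show ?thesis by (simp add: summable_ideal_def)
  qed
  show "F \<in> summable_ideal" if "finite F \<and> F \<subseteq> UNIV" for F
    using that by (simp add: summable_ideal_def)
  show "UNIV \<notin> summable_ideal"
  proof
    assume "UNIV \<in> summable_ideal"
    then have "summable ?w" by (simp add: summable_ideal_def summable_on_UNIV_nonneg_real_iff)
    then have "summable (\<lambda>n. inverse (real (Suc n)))" by (simp add: field_simps)
    then have "summable (\<lambda>n. inverse (real n))" by (subst (asm) summable_Suc_iff)
    then show False using not_summable_harmonic[where 'a = real] by simp
  qed
qed simp

lemma sum_UN_le:
  fixes w :: "'a \<Rightarrow> real"
  assumes "finite I" "\<And>i. i \<in> I \<Longrightarrow> finite (W i)" "\<And>v. 0 \<le> w v"
  shows "sum w (\<Union>i\<in>I. W i) \<le> (\<Sum>i\<in>I. sum w (W i))"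
  using assms(1,2)
proof (induction I rule: finite_induct)
  case (insert i I)
  have "sum w (W i \<union> (\<Union>i\<in>I. W i)) \<le> sum w (W i) + sum w (\<Union>i\<in>I. W i)"
    using insert by (subst sum_Un) (auto intro: sum_nonneg assms(3))
  then show ?case using insert by simp
qed simp

lemma summable_ideal_UN:
  fixes W :: "nat \<Rightarrow> nat set"
  assumes fin: "\<And>n. finite (W n)" and b: "\<And>n. (\<Sum>v\<in>W n. 1 / (real v + 1)) \<le> b n" "summable b"
  shows "(\<Union>n. W n) \<in> summable_ideal"
proof -
  let ?w = "\<lambda>v. 1 / (real v + 1)"
  have b_nonneg: "0 \<le> b n" for n using sum_nonneg[of "W n" ?w] b(1)[of n] by simp
  have "sum ?w F \<le> suminf b" if F: "F \<subseteq> (\<Union>n. W n)" "finite F" for F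
  proof -
    have "\<forall>v\<in>F. \<exists>n. v \<in> W n" using F(1) by blast
    from bchoice[OF this] obtain k where k: "\<And>v. v \<in> F \<Longrightarrow> v \<in> W (k v)" by blast
    obtain N where N: "k ` F \<subseteq> {..<N}"
      using finite_imageI[OF F(2), of k] unfolding finite_nat_iff_bounded by blast
    have "sum ?w F \<le> sum ?w (\<Union>n\<in>{..<N}. W n)" using fin N k by (intro sum_mono2) auto
    also have "\<dots> \<le> (\<Sum>n<N. sum ?w (W n))" by (intro sum_UN_le fin) auto
    also have "\<dots> \<le> (\<Sum>n<N. b n)" by (intro sum_mono b)
    also have "\<dots> \<le> suminf b" by (intro sum_le_suminf b b_nonneg) auto
    finally show ?thesis .
  qed
  then show ?thesis
    unfolding summable_ideal_def mem_Collect_eq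
    by (intro nonneg_bdd_above_summable_on bdd_aboveI[where M = "suminf b"]) auto
qed

definition enat_nbhd :: "enat \<Rightarrow> nat \<Rightarrow> enat set" where
  "enat_nbhd l N = insert l {enat N<..}"

lemma open_enat_nbhd: "open (enat_nbhd l N)"
proof (cases l)
  case (enat m)
  then have "enat_nbhd l N = {enat m} \<union> {enat N<..}" by (auto simp: enat_nbhd_def)
  then show ?thesis by (simp only: open_Un open_enat open_greaterThan)
next
  case infinity
  then have "enat_nbhd l N = {enat N<..}" by (auto simp: enat_nbhd_def)
  then show ?thesis by simp
qed

lemma closed_enat_nbhd: "closed (enat_nbhd l N)"
proof -
  have "{enat N<..} = {enat (Suc N)..}" by (auto simp: Suc_ile_eq)
  then show ?thesis by (simp add: enat_nbhd_def)
qed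

lemma eventually_enat_nbhd:
  assumes "(f \<longlongrightarrow> l) F"
  shows "\<forall>\<^sub>F y in F. f y \<in> enat_nbhd l N"
  by (rule topological_tendstoD[OF assms open_enat_nbhd]) (simp add: enat_nbhd_def)

lemma ultrafilter_tendsto_enat:
  assumes "ultrafilter p"
  obtains l :: enat where "(f \<longlongrightarrow> l) p"
proof (cases "\<exists>m. \<forall>\<^sub>F y in p. f y = enat m")
  case True
  then show ?thesis using that tendsto_eventually by blast
next
  case False
  have "(f \<longlongrightarrow> \<infinity>) p"
  proof (rule order_tendstoI)
    fix a :: enat assume "a < \<infinity>"
    then obtain N where N: "a = enat N" by (cases a) auto
    have "\<forall>\<^sub>F y in p. \<forall>m\<in>{..N}. f y \<noteq> enat m"
      using False ultrafilter_not_eventually[OF assms] by (intro eventually_ball_finite) auto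
    then show "\<forall>\<^sub>F y in p. a < f y"
    proof eventually_elim
      case (elim y)
      then show ?case using N by (cases "f y") (auto simp: not_less[symmetric])
    qed
  qed simp
  then show ?thesis using that by blast
qed

lemma few_large_values_summable:
  fixes W :: "nat \<Rightarrow> nat set"
  assumes fin: "\<And>n. finite (W n)" and card: "\<And>n. card (W n) \<le> 2 * 2 ^ n"
    and large: "\<And>n v. v \<in> W n \<Longrightarrow> 4 ^ n < v"
  shows "(\<Union>n. W n) \<in> summable_ideal"
proof (rule summable_ideal_UN[OF fin])
  show "(\<Sum>v\<in>W n. 1 / (real v + 1)) \<le> 2 * (1 / 2) ^ n" for n
  proof -
    have "1 / (real v + 1) \<le> (1 / 4) ^ n" if "v \<in> W n" for v
    proof -
      have "4 ^ n < real v" using large[OF that] by simp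
      then have "1 / (real v + 1) \<le> 1 / 4 ^ n" by (intro frac_le zero_less_power; linarith)
      then show ?thesis by (simp add: power_one_over)
    qed
    then have "(\<Sum>v\<in>W n. 1 / (real v + 1)) \<le> real (card (W n)) * (1 / 4) ^ n"
      by (rule sum_bounded_above)
    also have "\<dots> \<le> real (2 * 2 ^ n) * (1 / 4) ^ n"
      using card[of n] by (intro mult_right_mono) (simp_all only: of_nat_le_iff, simp)
    also have "\<dots> = 2 * (1 / 2) ^ n" by (simp flip: power_mult_distrib)
    finally show ?thesis .
  qed
qed (auto intro: summable_mult)

lemma few_new_values_summable:
  fixes A :: "nat \<Rightarrow> enat set"
  assumes fin: "\<And>n. finite (A n)" and card: "\<And>n. card (A n) \<le> 2 * 2 ^ n"
    and new: "\<And>n v. v \<in> A n \<Longrightarrow> \<exists>l'\<in>insert l (\<Union>m<n. A m). v \<in> enat_nbhd l' (4 ^ n)"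
  shows "{v. enat v \<in> (\<Union>n. A n)} \<in> summable_ideal"
proof -
  define W where "W n = {v. enat v \<in> A n \<and> 4 ^ n < v}" for n
  have W: "inj_on enat (W n)" "enat ` W n \<subseteq> A n" for n by (auto simp: W_def inj_on_def)
  have "(\<Union>n. W n) \<in> summable_ideal"
  proof (rule few_large_values_summable)
    show "finite (W n)" for n by (rule inj_on_finite[OF W fin])
    show "card (W n) \<le> 2 * 2 ^ n" for n
      using card_inj_on_le[OF W fin] card by (rule order_trans)
  qed (simp add: W_def)
  moreover have "finite {v. enat v = l}" by (rule finite_subset[of _ "{the_enat l}"]) auto
  then have "{v. enat v = l} \<in> summable_ideal"
    by (simp add: ideal_on_finite[OF ideal_on_summable_ideal])
  ultimately have "(\<Union>n. W n) \<union> {v. enat v = l} \<in> summable_ideal"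
    by (rule ideal_on_Un[OF ideal_on_summable_ideal])
  moreover have "v \<in> (\<Union>n. W n) \<union> {v. enat v = l}" if "enat v \<in> A n" for v n
    using that
  proof (induction n rule: less_induct)
    case (less n)
    then obtain l' where "l' \<in> insert l (\<Union>m<n. A m)" "enat v \<in> enat_nbhd l' (4 ^ n)"
      using new by blast
    then show ?case using less by (auto simp: enat_nbhd_def W_def)
  qed
  then have "{v. enat v \<in> (\<Union>n. A n)} \<subseteq> (\<Union>n. W n) \<union> {v. enat v = l}" by blast
  ultimately show ?thesis by (rule ideal_on_subset[OF ideal_on_summable_ideal])
qed

lemma idempotent_filter_eventually_limit_near:
  fixes p :: "'a::semigroup_add filter" and h :: "'a \<Rightarrow> enat"
  assumes "p \<noteq> bot" "idempotent_filter p" and lim: "\<And>s. ((\<lambda>y. h (s + y)) \<longlongrightarrow> L s) p"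
  shows "\<forall>\<^sub>F x in p. L (s + x) \<in> enat_nbhd (L s) N"
  using idempotent_filter_translate[OF assms(2) eventually_enat_nbhd[OF lim[of s], of N]]
proof eventually_elim
  case (elim x)
  then show ?case using Lim_in_closed_set[OF closed_enat_nbhd _ assms(1) lim] by blast
qed

lemma FS_near_limits_sequence:
  fixes f :: "nat \<Rightarrow> nat" and N :: "nat \<Rightarrow> nat"
  obtains x L where "strict_mono x"
    "\<And>n I. I \<subseteq> {..<n} \<Longrightarrow> enat (f (sum x I + x n)) \<in> enat_nbhd (L (sum x I)) (N n)"
    "\<And>n I. I \<subseteq> {..<n} \<Longrightarrow> L (sum x I + x n) \<in> enat_nbhd (L (sum x I)) (N n)"
proof -
  obtain p :: "nat filter" where p: "ultrafilter p" "idempotent_filter p" "p \<le> at_top"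
    using idempotent_ultrafilter_FS_exists[OF infinite_UNIV_nat] by blast
  have proper: "p \<noteq> bot" using p(1) by (rule ultrafilter_imp_neq_bot)
  have "\<exists>l. ((\<lambda>y. enat (f (s + y))) \<longlongrightarrow> l) p" for s using ultrafilter_tendsto_enat[OF p(1)] by blast
  then obtain L where L: "\<And>s. ((\<lambda>y. enat (f (s + y))) \<longlongrightarrow> L s) p" by metis
  define near where "near n s r \<longleftrightarrow>
    enat (f (s + r)) \<in> enat_nbhd (L s) (N n) \<and> L (s + r) \<in> enat_nbhd (L s) (N n)" for n s r
  have eventually_near: "\<forall>\<^sub>F r in p. near n s r" for n s
    unfolding near_def
    using eventually_enat_nbhd[OF L] idempotent_filter_eventually_limit_near[OF proper p(2) L]
    by (rule eventually_conj)
  obtain x where x: "strict_mono x" "\<And>n. \<forall>I\<in>Pow {..<n}. near n (sum x I) (x n)"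
  proof (rule strict_mono_sequence_along_filter[OF proper p(3),
        of "\<lambda>x n r. \<forall>I\<in>Pow {..<n}. near n (sum x I) r"])
    fix x y :: "nat \<Rightarrow> nat" and n r assume "\<And>i. i < n \<Longrightarrow> x i = y i"
    then have "sum x I = sum y I" if "I \<in> Pow {..<n}" for I using that by (intro sum.cong) auto
    then show "(\<forall>I\<in>Pow {..<n}. near n (sum x I) r) \<longleftrightarrow> (\<forall>I\<in>Pow {..<n}. near n (sum y I) r)" by simp
  qed (intro eventually_ball_finite ballI eventually_near, simp_all)
  then show ?thesis using that[of x L] by (auto simp: near_def)
qed

lemma FS_image_summable:
  fixes f :: "nat \<Rightarrow> nat"
  obtains D where "infinite D" "f ` FS D \<in> summable_ideal"
proof -
  obtain x L where x: "strict_mono x"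
    and f_near: "\<And>n I. I \<subseteq> {..<n} \<Longrightarrow> enat (f (sum x I + x n)) \<in> enat_nbhd (L (sum x I)) (4 ^ n)"
    and L_near: "\<And>n I. I \<subseteq> {..<n} \<Longrightarrow> L (sum x I + x n) \<in> enat_nbhd (L (sum x I)) (4 ^ n)"
    using FS_near_limits_sequence[of f "\<lambda>n. 4 ^ n"] by blast
  have inj: "inj x" using x by (rule strict_mono_imp_inj_on)
  define A where "A n = (\<lambda>I. enat (f (sum x I + x n))) ` Pow {..<n} \<union>
    (\<lambda>I. L (sum x I + x n)) ` Pow {..<n}" for n
  have "{v. enat v \<in> (\<Union>n. A n)} \<in> summable_ideal"
  proof (rule few_new_values_summable[where l = "L 0"])
    fix n
    show "finite (A n)" by (simp add: A_def)
    have "card (A n) \<le> card (Pow {..<n}) + card (Pow {..<n})"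
      unfolding A_def by (intro order_trans[OF card_Un_le] add_mono card_image_le) simp_all
    then show "card (A n) \<le> 2 * 2 ^ n" by (simp add: card_Pow)
    fix v assume "v \<in> A n"
    then obtain I where I: "I \<subseteq> {..<n}" "v \<in> enat_nbhd (L (sum x I)) (4 ^ n)"
      using f_near[of _ n] L_near[of _ n] by (auto simp: A_def)
    have "L (sum x I) \<in> insert (L 0) (\<Union>m<n. A m)"
    proof (cases rule: sum_Max_cases[OF finite_subset[OF I(1) finite_lessThan], where x = x])
      case (2 m J)
      then have "L (sum x I) \<in> A m" "m < n" using I(1) by (auto simp: A_def)
      then show ?thesis by blast
    qed simp
    then show "\<exists>l'\<in>insert (L 0) (\<Union>m<n. A m). v \<in> enat_nbhd l' (4 ^ n)" using I(2) by blast
  qed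
  moreover have "f ` FS (range x) \<subseteq> {v. enat v \<in> (\<Union>n. A n)}"
  proof clarify
    fix y assume "y \<in> FS (range x)"
    then obtain n I where "I \<subseteq> UNIV \<inter> {..<n}" "y = sum x I + x n"
      using inj by (rule FS_image_cases)
    then show "enat (f y) \<in> (\<Union>n. A n)" by (auto simp: A_def)
  qed
  ultimately have "f ` FS (range x) \<in> summable_ideal"
    by (rule ideal_on_subset[OF ideal_on_summable_ideal])
  then show ?thesis using that range_inj_infinite[OF inj] by blast
qed

lemma nsets_2_near_limits_sequence:
  fixes f :: "nat set \<Rightarrow> nat" and N :: "nat \<Rightarrow> nat"
  obtains x L l where "strict_mono x" "\<And>n. L (x n) \<in> enat_nbhd l (N n)"
    "\<And>i n. i < n \<Longrightarrow> enat (f {x i, x n}) \<in> enat_nbhd (L (x i)) (N n)"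
proof -
  obtain p :: "nat filter" where p: "ultrafilter p" "p \<le> at_top"
    using free_ultrafilter_exists[OF infinite_UNIV_nat] by blast
  have "\<exists>l. ((\<lambda>b. enat (f {a, b})) \<longlongrightarrow> l) p" for a using ultrafilter_tendsto_enat[OF p(1)] by blast
  then obtain L where L: "\<And>a. ((\<lambda>b. enat (f {a, b})) \<longlongrightarrow> L a) p" by metis
  obtain l where l: "(L \<longlongrightarrow> l) p" using ultrafilter_tendsto_enat[OF p(1)] .
  define near where "near x n r \<longleftrightarrow> L r \<in> enat_nbhd l (N n) \<and>
    (\<forall>i\<in>{..<n}. enat (f {x i, r}) \<in> enat_nbhd (L (x i)) (N n))" for x n r
  obtain x where "strict_mono x" "\<And>n. near x n (x n)"
  proof (rule strict_mono_sequence_along_filter[OF ultrafilter_imp_neq_bot[OF p(1)] p(2), of near])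
    show "\<forall>\<^sub>F r in p. near x n r" for x n
      unfolding near_def
      by (intro eventually_conj eventually_ball_finite ballI eventually_enat_nbhd l L) simp
  qed (simp_all add: near_def)
  then show ?thesis using that[of x L l] by (simp add: near_def)
qed

lemma nsets_2_image_summable:
  fixes f :: "nat set \<Rightarrow> nat"
  obtains D where "infinite D" "f ` [D]\<^bsup>2\<^esup> \<in> summable_ideal"
proof -
  obtain x L l where x: "strict_mono x" and L_near: "\<And>n. L (x n) \<in> enat_nbhd l (4 ^ n)"
    and f_near: "\<And>i n. i < n \<Longrightarrow> enat (f {x i, x n}) \<in> enat_nbhd (L (x i)) (4 ^ n)"
    using nsets_2_near_limits_sequence[of "\<lambda>n. 4 ^ n" f] by blast
  define A where "A n = insert (L (x n)) ((\<lambda>i. enat (f {x i, x n})) ` {..<n})" for n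
  have "{v. enat v \<in> (\<Union>n. A n)} \<in> summable_ideal"
  proof (rule few_new_values_summable[where l = l])
    fix n
    show "finite (A n)" by (simp add: A_def)
    have "card (A n) \<le> Suc (card ((\<lambda>i. enat (f {x i, x n})) ` {..<n}))"
      unfolding A_def by (rule card_insert_le_m1) simp_all
    also have "\<dots> \<le> Suc n" using card_image_le[of "{..<n}"] by simp
    also have "\<dots> \<le> 2 * 2 ^ n" using less_exp[of n] by linarith
    finally show "card (A n) \<le> 2 * 2 ^ n" .
    fix v assume "v \<in> A n"
    then consider "v = L (x n)" | i where "i < n" "v = enat (f {x i, x n})" by (auto simp: A_def)
    then show "\<exists>l'\<in>insert l (\<Union>m<n. A m). v \<in> enat_nbhd l' (4 ^ n)"
    proof cases
      case (2 i)
      then have "L (x i) \<in> (\<Union>m<n. A m)" by (auto simp: A_def)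
      then show ?thesis using 2 f_near by blast
    qed (use L_near in auto)
  qed
  moreover have "f ` [range x]\<^bsup>2\<^esup> \<subseteq> {v. enat v \<in> (\<Union>n. A n)}"
    by (auto simp: A_def elim!: nsets_2_image_cases)
  ultimately have "f ` [range x]\<^bsup>2\<^esup> \<in> summable_ideal"
    by (rule ideal_on_subset[OF ideal_on_summable_ideal])
  then show ?thesis using that range_inj_infinite strict_mono_imp_inj_on[OF x] by blast
qed

lemma summable_ideal_not_katetov_le_Hindman_ideal:
  "\<not> katetov_le UNIV summable_ideal UNIV Hindman_ideal"
  unfolding Hindman_ideal_eq
  by (subst not_katetov_le_indexed_ideal_iff[OF ideal_on_summable_ideal])
    (use FS_image_summable in blast)+

lemma summable_ideal_not_katetov_le_Ramsey_ideal:
  "\<not> katetov_le UNIV summable_ideal ([UNIV]\<^bsup>2\<^esup>) Ramsey_ideal"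
  unfolding Ramsey_ideal_eq
  by (subst not_katetov_le_indexed_ideal_iff[OF ideal_on_summable_ideal])
    (use nsets_2_image_summable in \<open>auto simp: nsets_mono\<close>)

lemma summable_ideal_not_katetov_le_Delta_ideal:
  "\<not> katetov_le UNIV summable_ideal UNIV Delta_ideal"
proof -
  have "\<exists>D. infinite D \<and> \<phi> ` Delta D \<in> summable_ideal" for \<phi> :: "nat \<Rightarrow> nat"
    using nsets_2_image_summable[of "\<lambda>e. \<phi> (Max e - Min e)"]
    by (metis Delta_eq_image_nsets_2 image_image)
  then show ?thesis
    by (simp add: Delta_ideal_eq not_katetov_le_indexed_ideal_iff[OF ideal_on_summable_ideal])
qed

section \<open>An almost disjoint family under the Continuum Hypothesis\<close>

lemma continuum_hypothesis_well_order:
  assumes continuum_hypothesis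
  obtains R :: "(real \<times> real) set" where "wf R" "\<And>a. countable {b. (b, a) \<in> R}"
    "\<And>a b. a \<noteq> b \<Longrightarrow> (a, b) \<in> R \<or> (b, a) \<in> R"
proof
  define r where "r = card_of (UNIV :: real set)"
  have r: "Well_order r" "Card_order r" "Field r = UNIV"
    unfolding r_def by (rule card_of_Well_order card_of_Card_order Field_card_of)+
  show "wf (r - Id)" using r(1) by (simp add: well_order_on_def)
  show "(a, b) \<in> r - Id \<or> (b, a) \<in> r - Id" if "a \<noteq> b" for a b
    using r(1,3) that by (auto simp: well_order_on_def linear_order_on_def total_on_def)
  show "countable {b. (b, a) \<in> r - Id}" for a
  proof (rule ccontr)
    assume "uncountable {b. (b, a) \<in> r - Id}"
    moreover have "{b. (b, a) \<in> r - Id} = underS r a" by (auto simp: underS_def)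
    ultimately have "underS r a \<approx> (UNIV :: real set)"
      using assms uncountable_infinite unfolding continuum_hypothesis_def by metis
    then have "(card_of (underS r a), r) \<in> ordIso"
      by (simp add: eqpoll_iff_card_of_ordIso r_def)
    moreover have "(card_of (underS r a), r) \<in> ordLess"
      using card_of_underS[OF r(2)] r(3) by blast
    ultimately show False using not_ordLess_ordIso by blast
  qed
qed

lemma Pow_countable_lepoll_real:
  assumes "countable \<Lambda>"
  shows "Pow \<Lambda> \<lesssim> (UNIV :: real set)"
proof -
  have "inj_on (\<lambda>A. to_nat_on \<Lambda> ` A) (Pow \<Lambda>)"
    using inj_on_image_Pow[OF inj_on_to_nat_on[OF assms]] .
  then have "Pow \<Lambda> \<lesssim> (UNIV :: nat set set)" unfolding lepoll_def by blast
  then show ?thesis using nat_sets_eqpoll_reals by (rule lepoll_trans2)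
qed

lemma Un_lepoll_infinite:
  assumes "infinite C" "A \<lesssim> C" "B \<lesssim> C"
  shows "A \<union> B \<lesssim> C"
  using card_of_Un_ordLeq_infinite_Field[OF _ _ _ card_of_Card_order, of C A B] assms
  by (simp add: lepoll_def card_of_ordLeq Field_card_of)

lemma Times_lepoll_infinite:
  assumes "infinite C" "A \<lesssim> C" "B \<lesssim> C"
  shows "A \<times> B \<lesssim> C"
  using card_of_Times_ordLeq_infinite_Field[OF _ _ _ card_of_Card_order, of C A B] assms
  by (simp add: lepoll_def card_of_ordLeq Field_card_of)

lemma set_pairs_enumerated_by_reals:
  assumes "countable \<Lambda>" "Q \<subseteq> Pow \<Lambda> \<times> Pow \<Lambda>" "Q \<noteq> {}"
  obtains e :: "real \<Rightarrow> 'a set \<times> 'a set" where "range e = Q"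
proof -
  have "Pow \<Lambda> \<times> Pow \<Lambda> \<lesssim> (UNIV :: real set)"
    by (intro Times_lepoll_infinite infinite_UNIV_char_0 Pow_countable_lepoll_real assms(1))
  with subset_imp_lepoll[OF assms(2)] have "Q \<lesssim> (UNIV :: real set)" by (rule lepoll_trans)
  then show ?thesis using that assms(3) unfolding lepoll_def by (metis inj_on_iff_surj)
qed

lemma almost_disjoint_selection:
  assumes J: "ideal_on \<Lambda> J" and B: "B \<subseteq> \<Lambda>" "B \<notin> J" and \<C>: "countable \<C>" "\<C> \<subseteq> J"
  obtains A where "A \<subseteq> B" "infinite A" "\<And>C. C \<in> \<C> \<Longrightarrow> finite (A \<inter> C)"
proof -
  define c where "c = from_nat_into (insert {} \<C>)"
  have range_c: "range c = insert {} \<C>"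
    unfolding c_def using \<C>(1) by (intro range_from_nat_into) auto
  have "insert {} \<C> \<subseteq> J" using \<C>(2) ideal_on_finite[OF J, of "{}"] by simp
  then have c: "c n \<in> J" for n unfolding range_c[symmetric] by blast
  have inf: "infinite (B - (\<Union>k\<le>n. c k))" for n
  proof
    assume "finite (B - (\<Union>k\<le>n. c k))"
    then have "B - (\<Union>k\<le>n. c k) \<in> J" using B(1) by (intro ideal_on_finite[OF J]) auto
    moreover have "(\<Union>k\<le>n. c k) \<in> J" by (intro ideal_on_UN[OF J] c) auto
    ultimately have "(B - (\<Union>k\<le>n. c k)) \<union> (\<Union>k\<le>n. c k) \<in> J" by (rule ideal_on_Un[OF J])
    then show False using ideal_on_subset[OF J] B(2) by blast
  qed
  have "\<exists>b. \<forall>n. b n \<in> B - (\<Union>k\<le>n. c k) - b ` {..<n}"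
  proof (rule dependent_wf_choice[OF wf_less])
    show "\<exists>r. r \<in> B - (\<Union>k\<le>n. c k) - b ` {..<n}" for n and b :: "nat \<Rightarrow> 'a"
      using infinite_imp_nonempty[of "B - (\<Union>k\<le>n. c k) - b ` {..<n}"] inf by auto
  qed (auto simp: image_iff)
  then obtain b where b: "\<And>n. b n \<in> B - (\<Union>k\<le>n. c k) - b ` {..<n}" by blast
  have "b m \<noteq> b n" if "m < n" for m n using b[of n] that by (metis DiffD2 imageI lessThan_iff)
  then have "inj b" by (rule linorder_injI)
  moreover have "finite (range b \<inter> C)" if "C \<in> \<C>" for C
  proof -
    have "C \<in> range c" using range_c that by simp
    then obtain k where k: "C = c k" by (rule rangeE)
    have "n < k" if "b n \<in> C" for n
      using b[of n] that k by (metis DiffD1 DiffD2 UN_I atMost_iff not_le)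
    then have "range b \<inter> C \<subseteq> b ` {..<k}" by auto
    then show ?thesis by (rule finite_subset) simp
  qed
  ultimately show ?thesis using that[of "range b"] b range_inj_infinite by blast
qed

definition tall :: "'a set \<Rightarrow> 'a set set \<Rightarrow> bool" where
  "tall \<Lambda> J \<longleftrightarrow> (\<forall>B\<subseteq>\<Lambda>. infinite B \<longrightarrow> (\<exists>A\<subseteq>B. infinite A \<and> A \<in> J))"

lemma transfinite_almost_disjoint_selection:
  assumes R: "wf R" "\<And>a. countable {b. (b, a) \<in> R}" and J: "ideal_on \<Lambda> J" "tall \<Lambda> J"
    and B: "\<And>a. B a \<subseteq> \<Lambda>" "\<And>a. B a \<notin> J" and C: "\<And>a. C a \<in> J"
  obtains A where "\<And>a. A a \<subseteq> B a" "\<And>a. infinite (A a)" "\<And>a. A a \<in> J"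
    "\<And>a b. (b, a) \<in> R \<Longrightarrow> finite (A a \<inter> A b)" "\<And>a b. (b, a) \<in> R \<Longrightarrow> finite (A a \<inter> C b)"
proof -
  define new_member where "new_member A a X \<longleftrightarrow> X \<subseteq> B a \<and> infinite X \<and> X \<in> J \<and>
    (\<forall>b. (b, a) \<in> R \<longrightarrow> finite (X \<inter> A b) \<and> finite (X \<inter> C b))" for A a X
  have "\<exists>A. \<forall>a. new_member A a (A a)"
  proof (rule dependent_wf_choice[OF R(1)])
    show "new_member A a X \<longleftrightarrow> new_member A' a X" if "\<And>b. (b, a) \<in> R \<Longrightarrow> A b = A' b" for A A' a X
      using that by (simp add: new_member_def)
  next
    fix a A assume A: "\<And>b. (b, a) \<in> R \<Longrightarrow> new_member A b (A b)"
    define \<C> where "\<C> = A ` {b. (b, a) \<in> R} \<union> C ` {b. (b, a) \<in> R}"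
    have "countable \<C>" using R(2) by (simp add: \<C>_def)
    moreover have "\<C> \<subseteq> J" using A C by (auto simp: \<C>_def new_member_def)
    ultimately obtain Y where Y: "Y \<subseteq> B a" "infinite Y" "\<And>Z. Z \<in> \<C> \<Longrightarrow> finite (Y \<inter> Z)"
      using almost_disjoint_selection[OF J(1) B] by metis
    obtain X where X: "X \<subseteq> Y" "infinite X" "X \<in> J"
      using J(2) Y(1,2) B(1)[of a] unfolding tall_def by (meson order_trans)
    have "finite (X \<inter> Z)" if "Z \<in> \<C>" for Z
      using Y(3)[OF that] X(1) by (meson Int_mono finite_subset subset_refl)
    then have "new_member A a X" using X Y(1) by (auto simp: new_member_def \<C>_def)
    then show "\<exists>X. new_member A a X" ..
  qed
  then obtain A where "\<And>a. new_member A a (A a)" by blast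
  then show ?thesis using that[of A] by (simp add: new_member_def)
qed

lemma almost_disjoint_selection_by_reals:
  fixes B C :: "real \<Rightarrow> 'a set"
  assumes CH: continuum_hypothesis and J: "ideal_on \<Lambda> J" "tall \<Lambda> J"
    and B: "\<And>a. B a \<subseteq> \<Lambda>" "\<And>a. B a \<notin> J" and C: "\<And>a. C a \<in> J"
  obtains A where "\<And>a. A a \<subseteq> B a" "\<And>a. infinite (A a)" "\<And>a. A a \<in> J"
    "\<And>a b. a \<noteq> b \<Longrightarrow> finite (A a \<inter> A b)" "\<And>a. countable {b. infinite (A b \<inter> C a)}"
proof -
  obtain R :: "(real \<times> real) set" where R: "wf R" "\<And>a. countable {b. (b, a) \<in> R}"
    "\<And>a b. a \<noteq> b \<Longrightarrow> (a, b) \<in> R \<or> (b, a) \<in> R"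
    using continuum_hypothesis_well_order[OF CH] by metis
  obtain A where A: "\<And>a. A a \<subseteq> B a" "\<And>a. infinite (A a)" "\<And>a. A a \<in> J"
    "\<And>a b. (b, a) \<in> R \<Longrightarrow> finite (A a \<inter> A b)" "\<And>a b. (b, a) \<in> R \<Longrightarrow> finite (A a \<inter> C b)"
    using transfinite_almost_disjoint_selection[OF R(1,2) J, where B = B and C = C, OF B C] by metis
  have "finite (A a \<inter> A b)" if "a \<noteq> b" for a b
    using R(3)[OF that] A(4)[of a b] A(4)[of b a] by (auto simp: Int_commute)
  moreover have "countable {b. infinite (A b \<inter> C a)}" for a
  proof (rule countable_subset)
    show "{b. infinite (A b \<inter> C a)} \<subseteq> insert a {b. (b, a) \<in> R}" using A(5) R(3) by blast
  qed (simp add: R(2))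
  ultimately show ?thesis using that A(1-3) by blast
qed

lemma almost_disjoint_family_range:
  assumes "\<And>a. A a \<subseteq> \<Lambda>" "\<And>a. infinite (A a)" "\<And>a b. a \<noteq> b \<Longrightarrow> finite (A a \<inter> A b)"
  shows "almost_disjoint_family \<Lambda> (range A)" "inj A"
proof -
  show "almost_disjoint_family \<Lambda> (range A)"
    unfolding almost_disjoint_family_def using assms by (metis imageE)
  show "inj A" by (rule injI) (metis assms(2,3) Int_absorb)
qed

lemma almost_disjoint_family_exists:
  assumes CH: continuum_hypothesis and \<Lambda>: "countable \<Lambda>" and J: "ideal_on \<Lambda> J" "tall \<Lambda> J"
  obtains \<A> where "almost_disjoint_family \<Lambda> \<A>" "uncountable \<A>" "\<A> \<subseteq> J"
    "\<And>B. B \<subseteq> \<Lambda> \<Longrightarrow> B \<notin> J \<Longrightarrow> \<exists>A\<in>\<A>. A \<subseteq> B" "\<And>C. C \<in> J \<Longrightarrow> countable {A \<in> \<A>. infinite (A \<inter> C)}"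
proof -
  define Q where "Q = (Pow \<Lambda> - J) \<times> J"
  have J_Pow: "J \<subseteq> Pow \<Lambda>" "\<Lambda> \<in> Pow \<Lambda> - J" "{} \<in> J" using J(1) by (auto simp: ideal_on_def)
  have "Q \<subseteq> Pow \<Lambda> \<times> Pow \<Lambda>" "Q \<noteq> {}" using J_Pow by (auto simp: Q_def)
  then obtain e :: "real \<Rightarrow> 'a set \<times> 'a set" where e: "range e = Q"
    by (rule set_pairs_enumerated_by_reals[OF \<Lambda>])
  have e_Q: "fst (e a) \<subseteq> \<Lambda>" "fst (e a) \<notin> J" "snd (e a) \<in> J" for a
    using rangeI[of e a] unfolding e Q_def by auto
  obtain A where A: "\<And>a. A a \<subseteq> fst (e a)" "\<And>a. infinite (A a)" "\<And>a. A a \<in> J"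
    "\<And>a b. a \<noteq> b \<Longrightarrow> finite (A a \<inter> A b)" "\<And>a. countable {b. infinite (A b \<inter> snd (e a))}"
    using almost_disjoint_selection_by_reals[OF CH J,
        where B = "\<lambda>a. fst (e a)" and C = "\<lambda>a. snd (e a)", OF e_Q] by metis
  have "A a \<subseteq> \<Lambda>" for a using A(3) J_Pow(1) by blast
  note AD = almost_disjoint_family_range[of A, OF this A(2,4)]
  show ?thesis
  proof (rule that[OF AD(1)])
    show "uncountable (range A)"
      using uncountable_UNIV_real AD(2) by (simp add: countable_image_inj_eq)
    show "range A \<subseteq> J" using A(3) by blast
    show "\<exists>A\<in>range A. A \<subseteq> B" if "B \<subseteq> \<Lambda>" "B \<notin> J" for B
    proof -
      have "(B, {}) \<in> range e" using that J_Pow(3) by (simp add: e Q_def)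
      then show ?thesis using A(1) by (metis fst_conv imageE rangeI)
    qed
    show "countable {X \<in> range A. infinite (X \<inter> C)}" if "C \<in> J" for C
    proof -
      have "(\<Lambda>, C) \<in> range e" using that J_Pow(2) by (simp add: e Q_def)
      then obtain a where "C = snd (e a)" by (metis imageE snd_conv)
      then have "{X \<in> range A. infinite (X \<inter> C)} = A ` {b. infinite (A b \<inter> snd (e a))}" by auto
      then show ?thesis using A(5) by simp
    qed
  qed
qed

section \<open>The one-point compactification of a Mrowka space\<close>

fun Psi_nbhd :: "'a + 'a set \<Rightarrow> ('a + 'a set) set" where
  "Psi_nbhd (Inl n) = {Inl n}"
| "Psi_nbhd (Inr A) = insert (Inr A) (Inl ` A)"

lemma Psi_nbhd_self: "i \<in> Psi_nbhd i"
  by (cases i) auto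

context
  fixes \<Lambda> :: "'a set" and \<A> :: "'a set set"
  assumes AD: "almost_disjoint_family \<Lambda> \<A>"
begin

lemma almost_disjointD:
  "A \<in> \<A> \<Longrightarrow> A \<subseteq> \<Lambda>" "A \<in> \<A> \<Longrightarrow> infinite A" "A \<in> \<A> \<Longrightarrow> B \<in> \<A> \<Longrightarrow> A \<noteq> B \<Longrightarrow> finite (A \<inter> B)"
  using AD by (auto simp: almost_disjoint_family_def)

lemma openin_Psi_iff:
  "openin (Psi \<Lambda> \<A>) U \<longleftrightarrow>
     U \<subseteq> topspace (Psi \<Lambda> \<A>) \<and> (\<forall>A\<in>\<A>. Inr A \<in> U \<longrightarrow> finite {n \<in> A. Inl n \<notin> U})"
proof -
  have "(\<exists>F. finite F \<and> insert (Inr A) (Inl ` (A - F)) \<subseteq> U) \<longleftrightarrow> finite {n \<in> A. Inl n \<notin> U}"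
    if "Inr A \<in> U" for A
  proof
    assume "\<exists>F. finite F \<and> insert (Inr A) (Inl ` (A - F)) \<subseteq> U"
    then obtain F where "finite F" "{n \<in> A. Inl n \<notin> U} \<subseteq> F" by auto
    then show "finite {n \<in> A. Inl n \<notin> U}" by (rule finite_subset[rotated])
  qed (use that in \<open>auto intro!: exI[of _ "{n \<in> A. Inl n \<notin> U}"]\<close>)
  then show ?thesis unfolding openin_Psi topspace_Psi[OF AD] by blast
qed

lemma finite_Int_Psi_nbhd:
  assumes "i \<in> topspace (Psi \<Lambda> \<A>)" "B \<in> \<A>" "Inr B \<notin> Psi_nbhd i"
  shows "finite {n \<in> B. Inl n \<in> Psi_nbhd i}"
proof (cases i)
  case (Inl m)
  then have "{n \<in> B. Inl n \<in> Psi_nbhd i} \<subseteq> {m}" by auto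
  then show ?thesis by (rule finite_subset) simp
next
  case (Inr A)
  then have "{n \<in> B. Inl n \<in> Psi_nbhd i} = A \<inter> B" by auto
  moreover have "A \<in> \<A>" "A \<noteq> B" using assms Inr by (auto simp: topspace_Psi[OF AD])
  ultimately show ?thesis using almost_disjointD(3) assms(2) by simp
qed

lemma Psi_nbhd_subset: "i \<in> topspace (Psi \<Lambda> \<A>) \<Longrightarrow> Psi_nbhd i \<subseteq> topspace (Psi \<Lambda> \<A>)"
  using almost_disjointD(1) by (cases i) (fastforce simp: topspace_Psi[OF AD])+

lemma openin_Psi_nbhd:
  assumes "i \<in> topspace (Psi \<Lambda> \<A>)"
  shows "openin (Psi \<Lambda> \<A>) (Psi_nbhd i)"
  unfolding openin_Psi_iff
  by (intro conjI Psi_nbhd_subset assms) (cases i; auto simp: image_iff)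

lemma closedin_Psi_nbhd:
  assumes "i \<in> topspace (Psi \<Lambda> \<A>)"
  shows "closedin (Psi \<Lambda> \<A>) (Psi_nbhd i)"
proof -
  have "{n \<in> B. Inl n \<notin> topspace (Psi \<Lambda> \<A>) - Psi_nbhd i} = {n \<in> B. Inl n \<in> Psi_nbhd i}"
    if "B \<in> \<A>" for B
    using almost_disjointD(1)[OF that] by (auto simp: topspace_Psi[OF AD])
  then have "openin (Psi \<Lambda> \<A>) (topspace (Psi \<Lambda> \<A>) - Psi_nbhd i)"
    using finite_Int_Psi_nbhd[OF assms] by (simp add: openin_Psi_iff)
  then show ?thesis by (simp add: closedin_def Psi_nbhd_subset assms)
qed

lemma compactin_Psi_nbhd:
  assumes "i \<in> topspace (Psi \<Lambda> \<A>)"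
  shows "compactin (Psi \<Lambda> \<A>) (Psi_nbhd i)"
proof (cases i)
  case (Inl n)
  then show ?thesis using assms by simp
next
  case (Inr A)
  then have A: "A \<in> \<A>" using assms by (auto simp: topspace_Psi[OF AD])
  show ?thesis
    unfolding compactin_def
  proof (intro conjI allI impI)
    fix \<U> assume \<U>: "(\<forall>U\<in>\<U>. openin (Psi \<Lambda> \<A>) U) \<and> Psi_nbhd i \<subseteq> \<Union>\<U>"
    then obtain U where U: "U \<in> \<U>" "Inr A \<in> U" using Inr by auto
    define rest :: "('a + 'a set) set" where "rest = Inl ` {n \<in> A. Inl n \<notin> U}"
    have "finite rest" using \<U> U A by (simp add: openin_Psi_iff rest_def)
    moreover have "rest \<subseteq> Psi_nbhd i" by (auto simp: rest_def Inr)
    ultimately have "compactin (Psi \<Lambda> \<A>) rest"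
      using Psi_nbhd_subset[OF assms] by (intro finite_imp_compactin) auto
    then obtain \<F> where "finite \<F>" "\<F> \<subseteq> \<U>" "rest \<subseteq> \<Union>\<F>"
      using \<U> \<open>rest \<subseteq> Psi_nbhd i\<close> unfolding compactin_def by (meson order_trans)
    moreover have "Psi_nbhd i \<subseteq> U \<union> rest" using U Inr by (auto simp: rest_def)
    ultimately show "\<exists>\<F>. finite \<F> \<and> \<F> \<subseteq> \<U> \<and> Psi_nbhd i \<subseteq> \<Union>\<F>"
      using U(1) by (intro exI[of _ "insert U \<F>"]) auto
  qed (rule Psi_nbhd_subset[OF assms])
qed

lemma compactin_Psi_cover:
  assumes "compactin (Psi \<Lambda> \<A>) C"
  obtains I where "finite I" "I \<subseteq> topspace (Psi \<Lambda> \<A>)" "C \<subseteq> (\<Union>i\<in>I. Psi_nbhd i)"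
proof -
  have "C \<subseteq> \<Union>(Psi_nbhd ` topspace (Psi \<Lambda> \<A>))"
    using compactin_subset_topspace[OF assms] Psi_nbhd_self by blast
  moreover have "\<forall>U\<in>Psi_nbhd ` topspace (Psi \<Lambda> \<A>). openin (Psi \<Lambda> \<A>) U"
    using openin_Psi_nbhd by blast
  ultimately obtain \<F> where "finite \<F>" "\<F> \<subseteq> Psi_nbhd ` topspace (Psi \<Lambda> \<A>)" "C \<subseteq> \<Union>\<F>"
    using assms unfolding compactin_def by meson
  then show ?thesis using that finite_subset_image[of \<F> Psi_nbhd] by metis
qed

lemma Hausdorff_space_Psi: "Hausdorff_space (Psi \<Lambda> \<A>)"
  unfolding Hausdorff_space_def
proof (intro allI impI)
  have separated: "\<exists>U V. openin (Psi \<Lambda> \<A>) U \<and> openin (Psi \<Lambda> \<A>) V \<and> x \<in> U \<and> y \<in> V \<and> disjnt U V"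
    if "x \<in> topspace (Psi \<Lambda> \<A>)" "y \<in> topspace (Psi \<Lambda> \<A>)" "y \<notin> Psi_nbhd x" for x y
    using that openin_Psi_nbhd[OF that(1)] closedin_Psi_nbhd[OF that(1)] Psi_nbhd_self[of x]
    by (intro exI[of _ "Psi_nbhd x"] exI[of _ "topspace (Psi \<Lambda> \<A>) - Psi_nbhd x"])
      (auto simp: closedin_def disjnt_def)
  fix x y assume xy: "x \<in> topspace (Psi \<Lambda> \<A>) \<and> y \<in> topspace (Psi \<Lambda> \<A>) \<and> x \<noteq> y"
  then have "y \<notin> Psi_nbhd x \<or> x \<notin> Psi_nbhd y" by (cases x; cases y) auto
  then show "\<exists>U V. openin (Psi \<Lambda> \<A>) U \<and> openin (Psi \<Lambda> \<A>) V \<and> x \<in> U \<and> y \<in> V \<and> disjnt U V"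
    using separated[of x y] separated[of y x] xy by (metis disjnt_sym)
qed

lemma locally_compact_space_Psi: "locally_compact_space (Psi \<Lambda> \<A>)"
  unfolding locally_compact_space_def
  using openin_Psi_nbhd compactin_Psi_nbhd Psi_nbhd_self by blast

lemma not_compact_space_Psi:
  assumes "infinite \<A>"
  shows "\<not> compact_space (Psi \<Lambda> \<A>)"
proof
  assume "compact_space (Psi \<Lambda> \<A>)"
  then obtain I where I: "finite I" "topspace (Psi \<Lambda> \<A>) \<subseteq> (\<Union>i\<in>I. Psi_nbhd i)"
    using compactin_Psi_cover unfolding compact_space_def by metis
  have "A \<in> Inr -` I" if "A \<in> \<A>" for A
  proof -
    have "Inr A \<in> topspace (Psi \<Lambda> \<A>)" using that by (simp add: topspace_Psi[OF AD])
    then obtain i where "i \<in> I" "Inr A \<in> Psi_nbhd i" using I(2) by blast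
    then show ?thesis by (cases i) auto
  qed
  then have "\<A> \<subseteq> Inr -` I" by blast
  moreover have "finite (Inr -` I)" using I(1) by (intro finite_vimageI) auto
  ultimately have "finite \<A>" by (rule finite_subset)
  then show False using assms by simp
qed

lemma Psi_closure_of_isolated: "Psi \<Lambda> \<A> closure_of (Inl ` \<Lambda>) = topspace (Psi \<Lambda> \<A>)"
proof (intro equalityI closure_of_subset_topspace subsetI)
  fix x assume x: "x \<in> topspace (Psi \<Lambda> \<A>)"
  have "\<exists>y. y \<in> Inl ` \<Lambda> \<and> y \<in> U" if U: "x \<in> U" "openin (Psi \<Lambda> \<A>) U" for U
  proof (cases x)
    case (Inl n)
    then show ?thesis using x U(1) by (auto simp: topspace_Psi[OF AD])
  next
    case (Inr A)
    then have A: "A \<in> \<A>" "finite {n \<in> A. Inl n \<notin> U}"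
      using x U by (auto simp: openin_Psi_iff topspace_Psi[OF AD])
    then have "infinite (A - {n \<in> A. Inl n \<notin> U})" using almost_disjointD(2) by simp
    then obtain n where "n \<in> A" "Inl n \<in> U" using infinite_imp_nonempty by blast
    then show ?thesis using almost_disjointD(1)[OF A(1)] by blast
  qed
  then show "x \<in> Psi \<Lambda> \<A> closure_of (Inl ` \<Lambda>)" using x by (simp add: in_closure_of)
qed

lemma topspace_Phi: "topspace (Phi \<Lambda> \<A>) = insert None (Some ` topspace (Psi \<Lambda> \<A>))"
  by (simp add: Phi_def)

lemma Hausdorff_space_Phi: "Hausdorff_space (Phi \<Lambda> \<A>)"
  by (simp add: Phi_def Hausdorff_space_Alexandroff_compactification Hausdorff_space_Psi
      locally_compact_space_Psi)

lemma compact_space_Phi: "compact_space (Phi \<Lambda> \<A>)"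
  by (simp add: Phi_def)

lemma separable_space_Phi:
  assumes "infinite \<A>" "countable \<Lambda>"
  shows "separable_space (Phi \<Lambda> \<A>)"
proof -
  let ?S = "Some ` Inl ` \<Lambda> :: ('a + 'a set) option set"
  have "Some ` topspace (Psi \<Lambda> \<A>) \<subseteq> Phi \<Lambda> \<A> closure_of ?S"
    using continuous_map_image_closure_subset[OF continuous_map_Some]
    unfolding Phi_def by (metis Psi_closure_of_isolated)
  then have "Phi \<Lambda> \<A> closure_of (Some ` topspace (Psi \<Lambda> \<A>)) \<subseteq> Phi \<Lambda> \<A> closure_of ?S"
    by (simp add: closure_of_minimal)
  moreover have "Phi \<Lambda> \<A> closure_of (Some ` topspace (Psi \<Lambda> \<A>)) = topspace (Phi \<Lambda> \<A>)"
    using Alexandroff_compactification_dense[OF not_compact_space_Psi[OF assms(1)]]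
    by (simp only: Phi_def)
  ultimately have "Phi \<Lambda> \<A> closure_of ?S = topspace (Phi \<Lambda> \<A>)"
    using closure_of_subset_topspace[of "Phi \<Lambda> \<A>" ?S] by simp
  moreover have "?S \<subseteq> topspace (Phi \<Lambda> \<A>)" by (auto simp: topspace_Phi topspace_Psi[OF AD])
  ultimately show ?thesis
    using assms(2) unfolding separable_space_def by (intro exI[of _ ?S]) simp
qed

lemma topspace_Phi_eqpoll_real:
  assumes continuum_hypothesis "countable \<Lambda>" "uncountable \<A>"
  shows "topspace (Phi \<Lambda> \<A>) \<approx> (UNIV :: real set)"
proof -
  have "\<A> \<subseteq> Pow \<Lambda>" using almost_disjointD(1) by blast
  then have \<A>: "\<A> \<lesssim> (UNIV :: real set)"
    using Pow_countable_lepoll_real[OF assms(2)] by (rule lepoll_trans[OF subset_imp_lepoll])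
  have \<Lambda>: "\<Lambda> \<lesssim> (UNIV :: real set)"
    using lepoll_Pow_self Pow_countable_lepoll_real[OF assms(2)] by (rule lepoll_trans)
  have "topspace (Phi \<Lambda> \<A>) = {None} \<union> Some ` (Inl ` \<Lambda> \<union> Inr ` \<A>)"
    by (simp add: topspace_Phi topspace_Psi[OF AD])
  also have "\<dots> \<lesssim> (UNIV :: real set)"
    by (intro Un_lepoll_infinite infinite_UNIV_char_0 lepoll_trans[OF image_lepoll] \<A> \<Lambda>
        finite_lepoll_infinite) simp
  finally have "topspace (Phi \<Lambda> \<A>) \<lesssim> (UNIV :: real set)" .
  then obtain k :: "_ \<Rightarrow> real" where k: "inj_on k (topspace (Phi \<Lambda> \<A>))"
    unfolding lepoll_def by blast
  have "(Some \<circ> Inr) ` \<A> \<subseteq> topspace (Phi \<Lambda> \<A>)" by (auto simp: topspace_Phi topspace_Psi[OF AD])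
  moreover have "uncountable ((Some \<circ> Inr :: _ \<Rightarrow> ('a + 'a set) option) ` \<A>)"
    using assms(3) by (simp add: countable_image_inj_eq inj_on_def)
  ultimately have "uncountable (topspace (Phi \<Lambda> \<A>))" using countable_subset by blast
  then have "uncountable (k ` topspace (Phi \<Lambda> \<A>))" by (simp add: countable_image_inj_eq[OF k])
  then have "k ` topspace (Phi \<Lambda> \<A>) \<approx> (UNIV :: real set)"
    using assms(1) uncountable_infinite unfolding continuum_hypothesis_def by blast
  with eqpoll_sym[OF inj_on_image_eqpoll_self[OF k]] show ?thesis by (rule eqpoll_trans)
qed

section \<open>Convergence in the one-point compactification\<close>

lemma openin_Phi_SomeE:
  assumes "openin (Phi \<Lambda> \<A>) U" "Some x \<in> U"
  obtains V where "openin (Psi \<Lambda> \<A>) V" "x \<in> V" "Some ` V \<subseteq> U"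
proof -
  consider V where "openin (Psi \<Lambda> \<A>) V" "U = Some ` V"
    | C where "closedin (Psi \<Lambda> \<A>) C" "U = insert None (Some ` (topspace (Psi \<Lambda> \<A>) - C))"
    using assms(1) unfolding Phi_def openin_Alexandroff_compactification by blast
  then show ?thesis
  proof cases
    case 1
    then show ?thesis using that assms(2) by blast
  next
    case 2
    then have "openin (Psi \<Lambda> \<A>) (topspace (Psi \<Lambda> \<A>) - C)" by (simp add: closedin_def)
    then show ?thesis using that 2(2) assms(2) by blast
  qed
qed

lemma openin_Phi_NoneE:
  assumes "openin (Phi \<Lambda> \<A>) U" "None \<in> U"
  obtains I where "finite I" "I \<subseteq> topspace (Psi \<Lambda> \<A>)"
    "topspace (Phi \<Lambda> \<A>) - (\<Union>i\<in>I. Some ` Psi_nbhd i) \<subseteq> U"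
proof -
  obtain C where C: "compactin (Psi \<Lambda> \<A>) C" "U = insert None (Some ` (topspace (Psi \<Lambda> \<A>) - C))"
    using assms unfolding Phi_def openin_Alexandroff_compactification by blast
  obtain I where "finite I" "I \<subseteq> topspace (Psi \<Lambda> \<A>)" "C \<subseteq> (\<Union>i\<in>I. Psi_nbhd i)"
    using compactin_Psi_cover[OF C(1)] .
  then show ?thesis using that C(2) by (fastforce simp: topspace_Phi)
qed

lemma limitin_Phi_NoneI:
  assumes "\<forall>\<^sub>F y in F. f y \<in> topspace (Phi \<Lambda> \<A>)"
    and "\<And>i. i \<in> topspace (Psi \<Lambda> \<A>) \<Longrightarrow> \<forall>\<^sub>F y in F. f y \<notin> Some ` Psi_nbhd i"
  shows "limitin (Phi \<Lambda> \<A>) f None F"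
  unfolding limitin_def
proof (intro conjI allI impI)
  fix U assume "openin (Phi \<Lambda> \<A>) U \<and> None \<in> U"
  then obtain I where I: "finite I" "I \<subseteq> topspace (Psi \<Lambda> \<A>)"
    "topspace (Phi \<Lambda> \<A>) - (\<Union>i\<in>I. Some ` Psi_nbhd i) \<subseteq> U"
    using openin_Phi_NoneE by metis
  have "\<forall>\<^sub>F y in F. \<forall>i\<in>I. f y \<notin> Some ` Psi_nbhd i"
    using I(1,2) assms(2) by (intro eventually_ball_finite) auto
  with assms(1) show "\<forall>\<^sub>F y in F. f y \<in> U" by eventually_elim (use I(3) in blast)
qed (simp add: topspace_Phi)

lemma limitin_Phi_InrI:
  assumes "A \<in> \<A>" "\<forall>\<^sub>F y in F. f y \<in> Some ` Inl ` A" "\<And>n. n \<in> A \<Longrightarrow> \<forall>\<^sub>F y in F. f y \<noteq> Some (Inl n)"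
  shows "limitin (Phi \<Lambda> \<A>) f (Some (Inr A)) F"
  unfolding limitin_def
proof (intro conjI allI impI)
  show "Some (Inr A) \<in> topspace (Phi \<Lambda> \<A>)"
    using assms(1) by (simp add: topspace_Phi topspace_Psi[OF AD])
  fix U assume "openin (Phi \<Lambda> \<A>) U \<and> Some (Inr A) \<in> U"
  then obtain V where V: "openin (Psi \<Lambda> \<A>) V" "Inr A \<in> V" "Some ` V \<subseteq> U"
    using openin_Phi_SomeE by metis
  have "finite {n \<in> A. Inl n \<notin> V}" using V(1,2) assms(1) by (simp add: openin_Psi_iff)
  then have "\<forall>\<^sub>F y in F. \<forall>n\<in>{n \<in> A. Inl n \<notin> V}. f y \<noteq> Some (Inl n)"
    by (intro eventually_ball_finite) (use assms(3) in auto)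
  with assms(2) show "\<forall>\<^sub>F y in F. f y \<in> U" by eventually_elim (use V(3) in blast)
qed

lemma limitin_Phi_SomeD:
  assumes "limitin (Phi \<Lambda> \<A>) f (Some i) F"
  shows "\<forall>\<^sub>F y in F. f y \<in> Some ` Psi_nbhd i"
proof -
  have "i \<in> topspace (Psi \<Lambda> \<A>)"
    using limitin_topspace[OF assms] by (auto simp: topspace_Phi)
  then have "openin (Phi \<Lambda> \<A>) (Some ` Psi_nbhd i)" by (simp add: Phi_def openin_Psi_nbhd)
  then show ?thesis using assms Psi_nbhd_self by (auto simp: limitin_def)
qed

lemma limitin_Phi_NoneD:
  assumes "limitin (Phi \<Lambda> \<A>) f None F" "i \<in> topspace (Psi \<Lambda> \<A>)"
  shows "\<forall>\<^sub>F y in F. f y \<notin> Some ` Psi_nbhd i"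
proof -
  have "openin (Phi \<Lambda> \<A>) (insert None (Some ` (topspace (Psi \<Lambda> \<A>) - Psi_nbhd i)))"
    unfolding Phi_def openin_Alexandroff_compactification
    using compactin_Psi_nbhd[OF assms(2)] closedin_Psi_nbhd[OF assms(2)] by blast
  then have "\<forall>\<^sub>F y in F. f y \<in> insert None (Some ` (topspace (Psi \<Lambda> \<A>) - Psi_nbhd i))"
    using assms(1) by (auto simp: limitin_def)
  then show ?thesis by (rule eventually_mono) auto
qed

lemma limitin_Phi_exists:
  assumes carrier: "\<forall>\<^sub>F y in F. f y \<in> topspace (Phi \<Lambda> \<A>)"
    and points: "\<And>z. decides F (f -` {z})"
    and members: "\<And>A. A \<in> \<A> \<Longrightarrow> decides F (f -` Some ` Inl ` A)"
  shows "\<exists>x. limitin (Phi \<Lambda> \<A>) f x F"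
proof -
  consider z where "z \<in> topspace (Phi \<Lambda> \<A>)" "\<forall>\<^sub>F y in F. f y = z"
    | A where "\<And>z. z \<in> topspace (Phi \<Lambda> \<A>) \<Longrightarrow> \<forall>\<^sub>F y in F. f y \<noteq> z"
        "A \<in> \<A>" "\<forall>\<^sub>F y in F. f y \<in> Some ` Inl ` A"
    | "\<And>z. z \<in> topspace (Phi \<Lambda> \<A>) \<Longrightarrow> \<forall>\<^sub>F y in F. f y \<noteq> z"
        "\<And>A. A \<in> \<A> \<Longrightarrow> \<forall>\<^sub>F y in F. f y \<notin> Some ` Inl ` A"
    using points members unfolding decides_def vimage_eq singleton_iff by blast
  then show ?thesis
  proof cases
    case (1 z)
    have "\<forall>\<^sub>F y in F. f y \<in> U" if "z \<in> U" for U
      using 1(2) by eventually_elim (use that in simp)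
    then show ?thesis using 1(1) unfolding limitin_def by blast
  next
    case (2 A)
    have "\<forall>\<^sub>F y in F. f y \<noteq> Some (Inl n)" if "n \<in> A" for n
      using that almost_disjointD(1)[OF 2(2)]
      by (intro 2(1)) (auto simp: topspace_Phi topspace_Psi[OF AD])
    then show ?thesis using limitin_Phi_InrI[OF 2(2,3)] by blast
  next
    case 3
    have "\<forall>\<^sub>F y in F. f y \<notin> Some ` Psi_nbhd i" if i: "i \<in> topspace (Psi \<Lambda> \<A>)" for i
    proof -
      have "\<forall>\<^sub>F y in F. f y \<noteq> Some i" using i by (intro 3(1)) (simp add: topspace_Phi)
      moreover have "\<forall>\<^sub>F y in F. f y \<notin> Some ` (Psi_nbhd i - {i})"
        using 3(2) i by (cases i) (auto simp: topspace_Psi[OF AD] image_def)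
      ultimately show ?thesis by eventually_elim blast
    qed
    then show ?thesis using limitin_Phi_NoneI[OF carrier] by blast
  qed
qed

lemma Psi_nbhd_trace_in_ideal:
  assumes J: "ideal_on \<Lambda> J" "\<A> \<subseteq> J" and i: "i \<in> topspace (Psi \<Lambda> \<A>)"
  shows "{n. Inl n \<in> Psi_nbhd i} \<in> J"
proof (cases i)
  case (Inl n)
  then have "{n. Inl n \<in> Psi_nbhd i} = {n}" "n \<in> \<Lambda>" using i by (auto simp: topspace_Psi[OF AD])
  then show ?thesis by (simp add: ideal_on_finite[OF J(1)])
next
  case (Inr A)
  then have "{n. Inl n \<in> Psi_nbhd i} = A" "A \<in> \<A>" using i by (auto simp: topspace_Psi[OF AD])
  then show ?thesis using J(2) by auto
qed

lemma Phi_notin_FinBW: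
  assumes J: "ideal_on \<Lambda> J" "\<A> \<subseteq> J" and positive: "\<And>B. B \<subseteq> \<Lambda> \<Longrightarrow> B \<notin> J \<Longrightarrow> \<exists>A\<in>\<A>. A \<subseteq> B"
  shows "Phi \<Lambda> \<A> \<notin> FinBW \<Lambda> J"
proof
  assume "Phi \<Lambda> \<A> \<in> FinBW \<Lambda> J"
  moreover have "Some \<circ> Inl \<in> \<Lambda> \<rightarrow> topspace (Phi \<Lambda> \<A>)"
    by (auto simp: topspace_Phi topspace_Psi[OF AD])
  ultimately obtain B x where B: "B \<subseteq> \<Lambda>" "B \<notin> J"
    and lim: "limitin (Phi \<Lambda> \<A>) (Some \<circ> Inl) x (inf cofinite (principal B))"
    unfolding FinBW_iff positive_sets_def by blast
  have finite_exceptions: "finite {n \<in> B. \<not> P n}"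
    if "\<forall>\<^sub>F n in inf cofinite (principal B). P n" for P
    using that by (simp add: eventually_inf_principal eventually_cofinite)
  show False
  proof (cases x)
    case None
    obtain A where A: "A \<in> \<A>" "A \<subseteq> B" using positive B by blast
    then have "Inr A \<in> topspace (Psi \<Lambda> \<A>)" by (simp add: topspace_Psi[OF AD])
    from finite_exceptions[OF limitin_Phi_NoneD[OF lim[unfolded None] this]]
    have "finite A" by (rule finite_subset[rotated]) (use A(2) in auto)
    then show False using almost_disjointD(2)[OF A(1)] by simp
  next
    case (Some i)
    have "i \<in> topspace (Psi \<Lambda> \<A>)" using limitin_topspace[OF lim] Some by (auto simp: topspace_Phi)
    then have trace: "{n. Inl n \<in> Psi_nbhd i} \<in> J" by (rule Psi_nbhd_trace_in_ideal[OF J])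
    have "{n \<in> B. (Some \<circ> Inl) n \<notin> Some ` Psi_nbhd i} \<in> J"
      using finite_exceptions[OF limitin_Phi_SomeD[OF lim[unfolded Some]]] B(1)
      by (intro ideal_on_finite[OF J(1)]) auto
    with trace have "{n. Inl n \<in> Psi_nbhd i} \<union> {n \<in> B. (Some \<circ> Inl) n \<notin> Some ` Psi_nbhd i} \<in> J"
      by (rule ideal_on_Un[OF J(1)])
    then have "B \<in> J" by (rule ideal_on_subset[OF J(1)]) auto
    then show False using B(2) by simp
  qed
qed

end

section \<open>Separating the indexed spaces from an ideal\<close>

context diagonally_Ramsey
begin

lemma not_katetov_leE:
  assumes "ideal_on \<Lambda>' J" "\<not> katetov_le \<Lambda>' J \<Lambda> (indexed_ideal \<Lambda> \<rho>)" "g \<in> \<Lambda> \<rightarrow> \<Lambda>'"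
  obtains D where "infinite D" "g ` \<rho> D \<in> J"
  using assms(2,3) unfolding not_katetov_le_indexed_ideal_iff[OF assms(1) subset_carrier] by auto

lemma not_katetov_le_imp_tall:
  fixes \<Lambda>' :: "'a set"
  assumes J: "ideal_on \<Lambda>' J" "\<not> katetov_le \<Lambda>' J \<Lambda> (indexed_ideal \<Lambda> \<rho>)"
  shows "tall \<Lambda>' J"
  unfolding tall_def
proof (intro allI impI)
  fix B assume B: "B \<subseteq> \<Lambda>'" "infinite B"
  obtain h :: "nat \<Rightarrow> 'a" where h: "inj h" "range h \<subseteq> B"
    using infinite_countable_subset[OF B(2)] by blast
  define g where "g = h \<circ> to_nat_on \<Lambda>"
  have "range g \<subseteq> B" using h(2) by (auto simp: g_def)
  then have "g \<in> \<Lambda> \<rightarrow> \<Lambda>'" using B(1) by blast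
  with J obtain D where D: "infinite D" "g ` \<rho> D \<in> J" by (rule not_katetov_leE)
  have "inj_on g \<Lambda>"
    unfolding g_def using countable_carrier h(1)
    by (intro comp_inj_on inj_on_to_nat_on) (auto intro: inj_on_subset)
  then have "infinite (g ` \<rho> D)"
    using infinite_index[OF D(1)] subset_carrier by (meson finite_imageD inj_on_subset)
  moreover have "g ` \<rho> D \<subseteq> B" using \<open>range g \<subseteq> B\<close> by blast
  ultimately show "\<exists>A\<subseteq>B. infinite A \<and> A \<in> J" using D(2) by blast
qed

lemma Phi_in_FinBW_indexed:
  fixes \<Lambda>' :: "'a set"
  assumes AD: "almost_disjoint_family \<Lambda>' \<A>"
    and J: "ideal_on \<Lambda>' J" "\<not> katetov_le \<Lambda>' J \<Lambda> (indexed_ideal \<Lambda> \<rho>)"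
    and few: "\<And>C. C \<in> J \<Longrightarrow> countable {A \<in> \<A>. infinite (A \<inter> C)}"
  shows "Phi \<Lambda>' \<A> \<in> FinBW_indexed \<Lambda> \<rho>"
  unfolding FinBW_indexed_def mem_Collect_eq
proof
  fix f assume f: "f \<in> \<Lambda> \<rightarrow> topspace (Phi \<Lambda>' \<A>)"
  obtain n where n: "n \<in> \<Lambda>'" using ideal_on_nonempty[OF J(1)] by blast
  define g where "g y = (case f y of Some (Inl m) \<Rightarrow> m | _ \<Rightarrow> n)" for y
  have "g y \<in> \<Lambda>'" if "y \<in> \<Lambda>" for y
    using funcset_mem[OF f that] n by (auto simp: g_def topspace_Phi[OF AD] topspace_Psi[OF AD])
  then have "g \<in> \<Lambda> \<rightarrow> \<Lambda>'" by blast
  with J obtain D where D: "infinite D" "g ` \<rho> D \<in> J" by (rule not_katetov_leE)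
  define isolated where "isolated A = (Some ` Inl ` A :: ('a + 'a set) option set)" for A
  have "countable (isolated ` {A \<in> \<A>. infinite (A \<inter> g ` \<rho> D)})" using few[OF D(2)] by simp
  then obtain E where E: "infinite E" "\<rho> E \<subseteq> \<rho> D"
    and points: "\<And>z. decides (tail_filter \<rho> E) (f -` {z})"
    and countable_members:
      "\<And>T. T \<in> isolated ` {A \<in> \<A>. infinite (A \<inter> g ` \<rho> D)} \<Longrightarrow> decides (tail_filter \<rho> E) (f -` T)"
    by (rule decide_vimages[OF D(1), where f = f]) blast
  note self = eventually_tail_filter_self[OF mono, of E]
  have members: "decides (tail_filter \<rho> E) (f -` isolated A)" if "A \<in> \<A>" for A
  proof (cases "finite (A \<inter> g ` \<rho> D)")
    case True
    then have "finite (isolated (A \<inter> g ` \<rho> D))" by (simp add: isolated_def)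
    then have "decides (tail_filter \<rho> E) (f -` isolated (A \<inter> g ` \<rho> D))"
      by (rule decides_vimage_finite) (rule points)
    moreover have "\<forall>\<^sub>F y in tail_filter \<rho> E. y \<in> f -` isolated A \<longleftrightarrow> y \<in> f -` isolated (A \<inter> g ` \<rho> D)"
      using self by (rule eventually_mono) (use E(2) in \<open>force simp: isolated_def g_def\<close>)
    ultimately show ?thesis by (simp only: decides_cong)
  qed (use that countable_members in blast)
  have "\<forall>\<^sub>F y in tail_filter \<rho> E. f y \<in> topspace (Phi \<Lambda>' \<A>)"
    using self by (rule eventually_mono) (use f subset_carrier in blast)
  then obtain x where "limitin (Phi \<Lambda>' \<A>) f x (tail_filter \<rho> E)"
    using limitin_Phi_exists[OF AD _ points] members unfolding isolated_def by blast
  then show "\<exists>D x. infinite D \<and> limitin (Phi \<Lambda>' \<A>) f x (tail_filter \<rho> D)" using E(1) by blast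
qed

lemma Phi_separating_FinBW_exists:
  assumes CH: continuum_hypothesis and \<Lambda>': "countable \<Lambda>'" "ideal_on \<Lambda>' \<I>"
    and not_le: "\<not> katetov_le \<Lambda>' \<I> \<Lambda> (indexed_ideal \<Lambda> \<rho>)"
  shows "\<exists>\<A> :: nat set set. almost_disjoint_family UNIV \<A> \<and> infinite \<A> \<and>
    Hausdorff_space (Phi UNIV \<A>) \<and> compact_space (Phi UNIV \<A>) \<and>
    separable_space (Phi UNIV \<A>) \<and> topspace (Phi UNIV \<A>) \<approx> (UNIV :: real set) \<and>
    Phi UNIV \<A> \<in> FinBW_indexed \<Lambda> \<rho> \<and> Phi UNIV \<A> \<notin> FinBW \<Lambda>' \<I>"
proof -
  obtain J :: "nat set set" where J: "ideal_on UNIV J"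
    and equiv: "katetov_le \<Lambda>' \<I> UNIV J" "katetov_le UNIV J \<Lambda>' \<I>"
    using ideal_on_nat_equivalent[OF \<Lambda>'] .
  have J_not_le: "\<not> katetov_le UNIV J \<Lambda> (indexed_ideal \<Lambda> \<rho>)"
    using katetov_le_trans[OF equiv(1)] not_le by blast
  have countable: "countable (UNIV :: nat set)" by simp
  obtain \<A> where AD: "almost_disjoint_family UNIV \<A>" and "uncountable \<A>" "\<A> \<subseteq> J"
    and positive: "\<And>B. B \<subseteq> UNIV \<Longrightarrow> B \<notin> J \<Longrightarrow> \<exists>A\<in>\<A>. A \<subseteq> B"
    and few: "\<And>C. C \<in> J \<Longrightarrow> countable {A \<in> \<A>. infinite (A \<inter> C)}"
    using almost_disjoint_family_exists[OF CH countable J not_katetov_le_imp_tall[OF J J_not_le]]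
    by blast
  have "infinite \<A>" using \<open>uncountable \<A>\<close> by (rule uncountable_infinite)
  moreover have "Phi UNIV \<A> \<notin> FinBW \<Lambda>' \<I>"
    using Phi_notin_FinBW[OF AD J \<open>\<A> \<subseteq> J\<close> positive] FinBW_antimono[OF equiv(2)] by blast
  ultimately show ?thesis
    using AD Hausdorff_space_Phi[OF AD] compact_space_Phi[OF AD]
      separable_space_Phi[OF AD \<open>infinite \<A>\<close> countable]
      topspace_Phi_eqpoll_real[OF AD CH countable \<open>uncountable \<A>\<close>]
      Phi_in_FinBW_indexed[OF AD J J_not_le few] by blast
qed

end

theorem corollary14p10:
  assumes "continuum_hypothesis"
  shows "(\<forall>(\<Lambda> :: 'a set) \<I>. countable \<Lambda> \<and> infinite \<Lambda> \<and> ideal_on \<Lambda> \<I> \<longrightarrow>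
        (\<not> katetov_le \<Lambda> \<I> UNIV Hindman_ideal \<longrightarrow>
         (\<exists>\<A> :: nat set set. almost_disjoint_family UNIV \<A> \<and> infinite \<A> \<and>
            Hausdorff_space (Phi UNIV \<A>) \<and> compact_space (Phi UNIV \<A>) \<and>
            separable_space (Phi UNIV \<A>) \<and> topspace (Phi UNIV \<A>) \<approx> (UNIV :: real set) \<and>
            Hindman_space (Phi UNIV \<A>) \<and> Phi UNIV \<A> \<notin> FinBW \<Lambda> \<I>)) \<and>
        (\<not> katetov_le \<Lambda> \<I> ([UNIV]\<^bsup>2\<^esup>) Ramsey_ideal \<longrightarrow>
         (\<exists>\<A> :: nat set set. almost_disjoint_family UNIV \<A> \<and> infinite \<A> \<and>
            Hausdorff_space (Phi UNIV \<A>) \<and> compact_space (Phi UNIV \<A>) \<and>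
            separable_space (Phi UNIV \<A>) \<and> topspace (Phi UNIV \<A>) \<approx> (UNIV :: real set) \<and>
            Ramsey_space (Phi UNIV \<A>) \<and> Phi UNIV \<A> \<notin> FinBW \<Lambda> \<I>)) \<and>
        (\<not> katetov_le \<Lambda> \<I> UNIV Delta_ideal \<longrightarrow>
         (\<exists>\<A> :: nat set set. almost_disjoint_family UNIV \<A> \<and> infinite \<A> \<and>
            Hausdorff_space (Phi UNIV \<A>) \<and> compact_space (Phi UNIV \<A>) \<and>
            separable_space (Phi UNIV \<A>) \<and> topspace (Phi UNIV \<A>) \<approx> (UNIV :: real set) \<and>
            differentially_compact_space (Phi UNIV \<A>) \<and> Phi UNIV \<A> \<notin> FinBW \<Lambda> \<I>))) \<and>
     (\<exists>\<A> :: nat set set. almost_disjoint_family UNIV \<A> \<and> infinite \<A> \<and>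
        Hausdorff_space (Phi UNIV \<A>) \<and> compact_space (Phi UNIV \<A>) \<and>
        separable_space (Phi UNIV \<A>) \<and> topspace (Phi UNIV \<A>) \<approx> (UNIV :: real set) \<and>
        Hindman_space (Phi UNIV \<A>) \<and> Phi UNIV \<A> \<notin> FinBW UNIV summable_ideal) \<and>
     (\<exists>\<A> :: nat set set. almost_disjoint_family UNIV \<A> \<and> infinite \<A> \<and>
        Hausdorff_space (Phi UNIV \<A>) \<and> compact_space (Phi UNIV \<A>) \<and>
        separable_space (Phi UNIV \<A>) \<and> topspace (Phi UNIV \<A>) \<approx> (UNIV :: real set) \<and>
        Ramsey_space (Phi UNIV \<A>) \<and> Phi UNIV \<A> \<notin> FinBW UNIV summable_ideal) \<and>
     (\<exists>\<A> :: nat set set. almost_disjoint_family UNIV \<A> \<and> infinite \<A> \<and>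
        Hausdorff_space (Phi UNIV \<A>) \<and> compact_space (Phi UNIV \<A>) \<and>
        separable_space (Phi UNIV \<A>) \<and> topspace (Phi UNIV \<A>) \<approx> (UNIV :: real set) \<and>
        differentially_compact_space (Phi UNIV \<A>) \<and> Phi UNIV \<A> \<notin> FinBW UNIV summable_ideal)"
proof -
  note exists = diagonally_Ramsey.Phi_separating_FinBW_exists[OF _ assms]
  note Hindman = exists[OF diagonally_Ramsey_FS, folded Hindman_ideal_eq Hindman_space_iff]
  note Ramsey = exists[OF diagonally_Ramsey_nsets_2, folded Ramsey_ideal_eq Ramsey_space_iff]
  note differentially_compact = exists[OF diagonally_Ramsey_Delta,
      folded Delta_ideal_eq differentially_compact_space_iff]
  note summable = countableI_type ideal_on_summable_ideal
  show ?thesis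
  proof (intro conjI allI impI, goal_cases)
    case (1 \<Lambda> \<I>)
    then show ?case by (intro Hindman) auto
  next
    case (2 \<Lambda> \<I>)
    then show ?case by (intro Ramsey) auto
  next
    case (3 \<Lambda> \<I>)
    then show ?case by (intro differentially_compact) auto
  next
    case 4
    show ?case by (rule Hindman[OF summable summable_ideal_not_katetov_le_Hindman_ideal])
  next
    case 5
    show ?case by (rule Ramsey[OF summable summable_ideal_not_katetov_le_Ramsey_ideal])
  next
    case 6
    show ?case
      by (rule differentially_compact[OF summable summable_ideal_not_katetov_le_Delta_ideal])
  qed
qed

end
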